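(* Let $K$ be a field of arbitrary characteristic. Let $g(X)\in K[X]$ be a nonzero polynomial with no double root, and let $\varphi(X,Z)\in K[X,Z]$ be monic in $Z$ with $\deg_Z(\varphi)\ge 2$ and such that the ideal $(\varphi(X,Z),\varphi_Z(X,Z))$ equals $K[X,Z]$. For $n\ge 2$ let $$A_n=\frac{K[X,Y,Z]}{(X^n g(X)Y-\varphi(X,Z))}.$$ Then the family $\{A_n : n\ge 2\}$ consists of pairwise non-isomorphic (as $K$-algebras) surfaces that are stably isomorphic; that is, for all $n\neq m$ with $n,m\ge 2$, $A_n\not\cong_K A_m$ while $A_n^{[1]}\cong_K A_m^{[1]}$.
   Context: $\varphi_Z$ denotes the partial derivative $\partial\varphi/\partial Z$. For a ring $R$, $R^{[1]}$ denotes the polynomial ring in one variable over $R$. $\cong_K$ denotes isomorphism of $K$-algebras. *)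

theory Defs
  imports
    "HOL-Algebra.QuotRing"
    "HOL-Algebra.UnivPoly"
    "HOL-Algebra.Algebraic_Closure_Type"
begin

text \<open>
  A commutative K-algebra is a commutative ring together with a structure map from K.
  An isomorphism of K-algebras is a ring isomorphism that commutes with the structure maps.
\<close>

definition alg_isomorphic ::
    "('a, 'm) ring_scheme \<Rightarrow> ('k \<Rightarrow> 'a) \<Rightarrow> ('b, 'n) ring_scheme \<Rightarrow> ('k \<Rightarrow> 'b) \<Rightarrow> bool"
  where "alg_isomorphic A \<iota> B \<kappa> \<longleftrightarrow> (\<exists>h \<in> ring_iso A B. \<forall>c. h (\<iota> c) = \<kappa> c)"

text \<open>
  \<open>K[X]\<close> is \<^typ>\<open>'k poly\<close>, \<open>K[X,Z]\<close> is \<open>K[X][Z]\<close> and \<open>K[X,Y,Z]\<close> is \<open>K[X][Z][Y]\<close>.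
  Thus for \<open>\<phi> :: 'k poly poly\<close> the degree, the leading coefficient and \<^const>\<open>pderiv\<close> all refer
  to \<open>Z\<close>. In the polynomial below, \<open>[:[:p:]:]\<close> is \<open>p(X)\<close>, \<open>[:0, 1:]\<close> is \<open>Y\<close> and \<open>[:\<phi>:]\<close>
  is \<open>\<phi>(X,Z)\<close>, all viewed in \<open>K[X,Y,Z]\<close>.
\<close>

definition surface_poly ::
    "'k::field poly \<Rightarrow> 'k poly poly \<Rightarrow> nat \<Rightarrow> 'k poly poly poly"
  where "surface_poly g \<phi> n = [:[:[:0, 1:] ^ n * g:]:] * [:0, 1:] - [:\<phi>:]"

abbreviation KXYZ :: "'k::field poly poly poly ring"
  where "KXYZ \<equiv> ring_of_type_algebra"

definition surface_ideal ::
    "'k::field poly \<Rightarrow> 'k poly poly \<Rightarrow> nat \<Rightarrow> 'k poly poly poly set"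
  where "surface_ideal g \<phi> n = PIdl\<^bsub>KXYZ\<^esub> (surface_poly g \<phi> n)"

definition surface_ring ::
    "'k::field poly \<Rightarrow> 'k poly poly \<Rightarrow> nat \<Rightarrow> 'k poly poly poly set ring"
  where "surface_ring g \<phi> n = KXYZ Quot surface_ideal g \<phi> n"

definition surface_const ::
    "'k::field poly \<Rightarrow> 'k poly poly \<Rightarrow> nat \<Rightarrow> 'k \<Rightarrow> 'k poly poly poly set"
  where "surface_const g \<phi> n c = surface_ideal g \<phi> n +>\<^bsub>KXYZ\<^esub> [:[:[:c:]:]:]"

definition up_const :: "('a, 'm) ring_scheme \<Rightarrow> ('k \<Rightarrow> 'a) \<Rightarrow> 'k \<Rightarrow> nat \<Rightarrow> 'a"
  where "up_const A \<iota> c = up_ring.monom (UP A) (\<iota> c) 0"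

lemma ideal_surface_ideal: "ideal (surface_ideal g \<phi> n) KXYZ"
proof -
  interpret cring "KXYZ :: 'a poly poly poly ring" by (rule cring_from_type_algebra)
  show ?thesis
    unfolding surface_ideal_def
    by (rule cgenideal_ideal) (simp add: ring_of_type_algebra_def)
qed

lemma cring_surface_ring: "cring (surface_ring g \<phi> n)"
  unfolding surface_ring_def
  by (rule ideal.quotient_is_cring[OF ideal_surface_ideal cring_from_type_algebra])

lemma surface_const_ring_hom:
  "surface_const g \<phi> n \<in> ring_hom ring_of_type_algebra (surface_ring g \<phi> n)"
proof -
  have 1: "(\<lambda>c::'a. [:[:[:c:]:]:]) \<in> ring_hom ring_of_type_algebra KXYZ"
    by (rule ring_hom_memI) (auto simp: ring_of_type_algebra_def one_pCons)
  show ?thesis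
    using ring_hom_trans[OF 1 ideal.rcos_ring_hom[OF ideal_surface_ideal[of g \<phi> n]]]
    by (simp add: surface_ring_def surface_const_def[abs_def] comp_def)
qed

end

theory Submission
  imports Defs "HOL-Computational_Algebra.Formal_Laurent_Series"
    "HOL-Computational_Algebra.Polynomial_FPS"
begin

text \<open>
  Throughout, \<open>q = X\<^sup>n g\<close>, \<open>d\<close> is the degree of \<open>\<phi>\<close> in \<open>Z\<close>, and \<open>\<alpha> \<phi> + \<beta> \<phi>\<^sub>Z = 1\<close>.
  Since \<open>\<phi>\<close> is monic, \<open>A = K[X,Y,Z]/(q Y - \<phi>)\<close> is the subring \<open>K[X][Z, \<phi>/q]\<close> of \<open>F[Z]\<close> for
  any field \<open>F\<close> containing \<open>K[X]\<close>; here \<open>F = K((X))\<close>. Every element has a unique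
  expansion \<open>\<Sum> c\<^sub>k(X,Z) Y\<^sup>k\<close> with all \<open>c\<^sub>k\<close> of \<open>Z\<close>-degree less than \<open>d\<close>
  (\<open>normal_form\<close>, \<open>normal_form_degree\<close>).

  \<^bold>\<open>The cylinders agree.\<close> Geometrically, the surfaces for \<open>q\<close> and \<open>p q\<close>, where \<open>p\<close> divides \<open>q\<close>,
  are torsors under the additive group over the same nonseparated curve, because \<open>\<phi>\<^sub>Z\<close> is
  invertible modulo \<open>\<phi>\<close>; both projections from their fibre product are trivial torsors, so this
  fibre product is both cylinders. Algebraically this is an automorphism of \<open>F[Z][T]\<close>,
  namely \<open>T \<mapsto> U = \<beta>(Z) \<phi>(Z)/q - p T\<close> and \<open>Z \<mapsto> Z - q U\<close>. One Newton step shows that it maps the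
  cylinder over the surface for \<open>p q\<close> onto the cylinder over the surface for \<open>q\<close>
  (\<open>cylinder_isomorphic\<close>). Taking \<open>p = X\<close> repeatedly reduces every exponent to \<open>1\<close>.

  \<^bold>\<open>The surfaces differ.\<close> The point is that an isomorphism between two of them preserves \<open>K[X]\<close>.
  Carry the additive group action \<open>X \<mapsto> X, Z \<mapsto> Z + q S\<close> of one surface over to the other.
  The carried action fixes some nonconstant \<open>t\<close>, and it is claimed that it fixes \<open>X\<close>
  (\<open>coordinate_X_invariant\<close>). Move all factors \<open>X\<close> of \<open>g\<close> into \<open>X\<^sup>n\<close>, so that \<open>g(0) \<noteq> 0\<close>. If \<open>X\<close> is not fixed,
  filter \<open>A\<close> by the order of vanishing along \<open>X = 0\<close>, give \<open>S\<close> the least weight that makes the action respect the filtration (\<open>optimal_weight\<close>), and take leading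
  forms \<open>\<xi>, \<zeta>, \<eta>\<close> of the images of \<open>X, Z, Y\<close>. These are polynomials in \<open>Z\<close> and \<open>S\<close>, at least one
  involves \<open>S\<close>, and up to a constant factor \<open>\<xi>\<^sup>n \<eta> = f(\<zeta>)\<close>, where \<open>f(Z) = \<phi>(0,Z)\<close>.
  The leading form of \<open>t\<close> must be fixed. If \<open>t\<close> has no pole along \<open>X = 0\<close>, then, up to an additive constant, \<open>t\<close> is divisible by \<open>X\<close>, and a
  divisor of a fixed element is fixed. If \<open>t\<close> has a pole, its leading form is divisible by \<open>Y\<close>, so
  \<open>\<eta>\<close> does not involve \<open>S\<close> and \<open>\<xi>\<^sup>n f(Z) = f(\<zeta>)\<close>. Since \<open>f\<close> is coprime to its derivative and
  \<open>n\<close> and \<open>d\<close> are at least \<open>2\<close>, comparing degrees after differentiation shows that such a curve is constant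
  (\<open>curve_tame\<close>, \<open>curve_wild\<close>), a contradiction.

  Hence an isomorphism acts on \<open>K[X]\<close> by an affine substitution; it then maps \<open>Z\<close> to
  \<open>\<mu> Z + \<nu>\<close> with a constant \<open>\<mu> \<noteq> 0\<close>, and the image of \<open>Y\<close> has \<open>Z\<close>-degree \<open>d\<close>. Leading coefficients of
  elements of degree \<open>d\<close> have a denominator dividing \<open>q\<close>, which makes \<open>deg q = n + deg g\<close> an invariant.
\<close>

section \<open>Homomorphisms out of polynomial rings\<close>

hide_const (open) Polynomials.degree Polynomials.lead_coeff up_ring.monom up_ring.coeff

locale rhom =
  fixes f :: "'a::comm_ring_1 \<Rightarrow> 'b::comm_ring_1"
  assumes hom_add: "f (a + b) = f a + f b"
    and hom_mult: "f (a * b) = f a * f b"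
    and hom_one: "f 1 = 1"
begin

lemma hom_zero: "f 0 = 0"
  using hom_add[of 0 0] by simp

lemma hom_uminus: "f (- a) = - f a"
  using hom_add[of a "- a"] by (simp add: hom_zero add_eq_0_iff)

lemma hom_diff: "f (a - b) = f a - f b"
  using hom_add[of a "- b"] by (simp add: hom_uminus)

lemma hom_power: "f (a ^ n) = f a ^ n"
  by (induction n) (simp_all add: hom_one hom_mult)

lemma hom_sum: "f (sum u A) = (\<Sum>x\<in>A. f (u x))"
  by (induction A rule: infinite_finite_induct) (simp_all add: hom_zero hom_add)

lemmas hom_simps = hom_add hom_mult hom_one hom_zero hom_uminus hom_diff hom_power

end

lemma rhom_comp: "rhom f \<Longrightarrow> rhom g \<Longrightarrow> rhom (\<lambda>x. g (f x))"
  by (simp add: rhom_def)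

lemma rhom_const: "rhom (\<lambda>c. [:c:])"
  by unfold_locales (simp_all add: one_pCons)

text \<open>The coefficient map is an argument because the homomorphisms below arise by nesting this
  construction, one variable at a time.\<close>

definition pev :: "('a::comm_ring_1 \<Rightarrow> 'b::comm_ring_1) \<Rightarrow> 'b \<Rightarrow> 'a poly \<Rightarrow> 'b"
  where "pev f x p = poly (map_poly f p) x"

lemma (in rhom) pev_pCons: "pev f x (pCons a p) = f a + x * pev f x p"
  by (simp add: pev_def map_poly_pCons hom_zero)

lemma pev_0 [simp]: "pev f x 0 = 0"
  by (simp add: pev_def)

lemma (in rhom) rhom_pev: "rhom (pev f x)"
proof
  show add: "pev f x (a + b) = pev f x a + pev f x b" for a b
    by (induction a b rule: poly_induct2) (simp_all add: pev_pCons hom_add algebra_simps)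
  have smult: "pev f x (smult c b) = f c * pev f x b" for c b
    by (induction b) (simp_all add: pev_pCons hom_mult algebra_simps)
  show "pev f x (a * b) = pev f x a * pev f x b" for a b
    by (induction a) (simp_all add: pev_pCons mult_pCons_left add smult hom_zero algebra_simps)
  show "pev f x 1 = 1"
    by (simp add: one_pCons pev_pCons hom_one)
qed

lemma (in rhom) pev_const: "pev f x [:a:] = f a"
  by (simp add: pev_pCons)

lemma (in rhom) pev_X: "pev f x [:0, 1:] = x"
  by (simp add: pev_pCons hom_zero hom_one)

lemma rhom_eq_pev:
  assumes "rhom H"
  shows "H p = pev (\<lambda>a. H [:a:]) (H [:0, 1:]) p"
proof -
  interpret H: rhom H by fact
  have c: "rhom (\<lambda>a. H [:a:])"
    by (rule rhom_comp[OF rhom_const assms])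
  show ?thesis
  proof (induction p)
    case (pCons a p)
    have "pCons a p = [:a:] + [:0, 1:] * p" by simp
    then have "H (pCons a p) = H [:a:] + H [:0, 1:] * H p"
      by (metis H.hom_add H.hom_mult)
    then show ?case
      by (simp only: rhom.pev_pCons[OF c] pCons.IH)
  qed (simp add: H.hom_zero)
qed

lemma (in rhom) coeff_hom: "Polynomial.coeff (map_poly f p) i = f (Polynomial.coeff p i)"
  by (simp add: coeff_map_poly hom_zero)

lemma (in rhom) rhom_map_poly: "rhom (map_poly f)"
  by unfold_locales
    (auto intro!: poly_eqI simp: coeff_hom hom_add hom_mult hom_sum coeff_mult hom_one hom_zero)

lemma (in rhom) map_poly_pCons': "map_poly f (pCons a p) = pCons (f a) (map_poly f p)"
  by (simp add: map_poly_pCons hom_zero)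

lemma (in rhom) pev_map_poly:
  assumes "rhom g" shows "pev g x (map_poly f p) = pev (\<lambda>a. g (f a)) x p"
  by (simp add: pev_def map_poly_map_poly hom_zero rhom.hom_zero[OF assms] comp_def)

lemma (in rhom) hom_pev:
  assumes "rhom g" shows "f (pev g x p) = pev (\<lambda>a. f (g a)) (f x) p"
proof -
  interpret g: rhom g by fact
  interpret fg: rhom "\<lambda>a. f (g a)" by (rule rhom_comp) (fact, unfold_locales)
  show ?thesis
    by (induction p) (simp_all add: g.pev_pCons fg.pev_pCons hom_simps)
qed

lemma (in rhom) pev_altdef: "pev f x p = (\<Sum>i\<le>degree p. f (coeff p i) * x ^ i)"
proof -
  have "pev f x (\<Sum>i\<le>degree p. Polynomial.monom (coeff p i) i) = (\<Sum>i\<le>degree p. f (coeff p i) * x ^ i)"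
    by (simp add: rhom.hom_sum[OF rhom_pev]) (simp add: pev_def map_poly_monom hom_zero poly_monom)
  then show ?thesis by (simp add: poly_as_sum_of_monoms)
qed

lemma degree_0_const: "degree p = 0 \<Longrightarrow> p = [:coeff p 0:]"
  by (metis degree_0_id)

section \<open>Expansions in powers of a polynomial\<close>

text \<open>The summands \<open>c\<^sub>k y\<^sup>k\<close> have degrees in the disjoint intervals \<open>[d k, d k + d)\<close>, so the last one
  dominates. This yields uniqueness of \<open>y\<close>-adic expansions, both for elements of the surface
  and for their leading forms.\<close>

lemma degree_poly_small_coeffs:
  fixes y :: "'a::idom poly" and P :: "'a poly poly"
  assumes y: "degree y = d" "d > 0"
    and small: "\<And>i. degree (coeff P i) < d" and "P \<noteq> 0"
  shows "degree (poly P y) = degree (lead_coeff P) + d * degree P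
       \<and> lead_coeff (poly P y) = lead_coeff (lead_coeff P) * lead_coeff y ^ degree P
       \<and> poly P y \<noteq> 0"
  using small \<open>P \<noteq> 0\<close>
proof (induction P)
  case (pCons a P)
  show ?case
  proof (cases "P = 0")
    case True
    then show ?thesis using pCons.prems by auto
  next
    case False
    have sm: "degree (coeff P i) < d" for i
      using pCons.prems(1)[of "Suc i"] by simp
    note IH = pCons.IH[OF sm False]
    have a: "degree a < d" using pCons.prems(1)[of 0] by simp
    have "y \<noteq> 0" using y by auto
    then have dp: "degree (y * poly P y) = d + (degree (lead_coeff P) + d * degree P)"
      using IH y by (simp add: degree_mult_eq)
    then have lt: "degree a < degree (y * poly P y)" using a by simp
    have "degree (a + y * poly P y) = degree (y * poly P y)"
      by (rule degree_add_eq_right[OF lt])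
    moreover have "lead_coeff (a + y * poly P y) = lead_coeff (y * poly P y)"
      by (rule lead_coeff_add_le[OF lt])
    moreover have "a + y * poly P y \<noteq> 0" using calculation(1) lt by auto
    moreover have "lead_coeff (y * poly P y) = lead_coeff y * lead_coeff (poly P y)"
      by (rule lead_coeff_mult)
    ultimately show ?thesis using IH False dp
      by (auto simp del: coeff_add simp: algebra_simps)
  qed
qed simp

section \<open>The surfaces as subrings of \<open>K((X))[Z]\<close>\<close>

text \<open>Laurent series are used instead of rational functions because the order of vanishing
  at \<open>X = 0\<close> and the leading coefficient can then be read off.\<close>

definition \<iota> :: "'k::field poly \<Rightarrow> 'k fls"
  where "\<iota> p = fps_to_fls (fps_of_poly p)"

lemma rhom_\<iota>: "rhom \<iota>"
  by unfold_locales (simp_all add: \<iota>_def fps_of_poly_add fps_of_poly_mult fls_times_fps_to_fls)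

interpretation \<iota>: rhom \<iota> by (rule rhom_\<iota>)

lemma \<iota>_eq_iff: "\<iota> p = \<iota> q \<longleftrightarrow> p = q"
  by (simp add: \<iota>_def fps_of_poly_eq_iff)

lemma \<iota>_eq_0_iff: "\<iota> p = 0 \<longleftrightarrow> p = 0"
  using \<iota>_eq_iff[of p 0] by (simp add: \<iota>.hom_zero)

definition \<epsilon> :: "'k::field poly poly \<Rightarrow> 'k fls poly"
  where "\<epsilon> = map_poly \<iota>"

lemma rhom_\<epsilon>: "rhom \<epsilon>"
  unfolding \<epsilon>_def by (rule \<iota>.rhom_map_poly)

interpretation \<epsilon>: rhom \<epsilon> by (rule rhom_\<epsilon>)

lemma degree_\<epsilon>: "degree (\<epsilon> p) = degree p"
  unfolding \<epsilon>_def by (rule degree_map_poly) (simp add: \<iota>_eq_0_iff)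

lemma coeff_\<epsilon>: "coeff (\<epsilon> p) i = \<iota> (coeff p i)"
  by (simp add: \<epsilon>_def \<iota>.coeff_hom)

lemma \<epsilon>_eq_iff: "\<epsilon> p = \<epsilon> q \<longleftrightarrow> p = q"
  by (simp add: poly_eq_iff coeff_\<epsilon> \<iota>_eq_iff)

lemma \<epsilon>_eq_0_iff: "\<epsilon> p = 0 \<longleftrightarrow> p = 0"
  using \<epsilon>_eq_iff[of p 0] by (simp add: \<epsilon>.hom_zero)

lemma \<epsilon>_const: "\<epsilon> [:c:] = [:\<iota> c:]"
  by (simp add: \<epsilon>_def map_poly_pCons \<iota>.hom_zero)

lemma \<epsilon>_pCons: "\<epsilon> (pCons c p) = pCons (\<iota> c) (\<epsilon> p)"
  by (simp add: \<epsilon>_def map_poly_pCons \<iota>.hom_zero)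

definition ycoord :: "'k::field poly \<Rightarrow> 'k poly poly \<Rightarrow> 'k fls poly"
  where "ycoord q \<phi> = smult (inverse (\<iota> q)) (\<epsilon> \<phi>)"

definition ev :: "'k::field poly \<Rightarrow> 'k poly poly \<Rightarrow> 'k poly poly poly \<Rightarrow> 'k fls poly"
  where "ev q \<phi> = pev \<epsilon> (ycoord q \<phi>)"

text \<open>The coordinate ring of the surface, with \<open>Y\<close> realised as \<open>\<phi>/q\<close>.\<close>

definition surf :: "'k::field poly \<Rightarrow> 'k poly poly \<Rightarrow> 'k fls poly set"
  where "surf q \<phi> = range (ev q \<phi>)"

definition surf_rel :: "'k::field poly \<Rightarrow> 'k poly poly \<Rightarrow> 'k poly poly poly"
  where "surf_rel q \<phi> = [:[:q:]:] * [:0, 1:] - [:\<phi>:]"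

lemma rhom_ev: "rhom (ev q \<phi>)"
  unfolding ev_def by (rule \<epsilon>.rhom_pev)

interpretation ev: rhom "ev q \<phi>" for q \<phi> by (rule rhom_ev)

lemma ev_const: "ev q \<phi> [:c:] = \<epsilon> c"
  by (simp add: ev_def \<epsilon>.pev_const)

lemma ev_Y: "ev q \<phi> [:0, 1:] = ycoord q \<phi>"
  by (simp add: ev_def \<epsilon>.pev_X)

lemma ev_pCons: "ev q \<phi> (pCons c p) = \<epsilon> c + ycoord q \<phi> * ev q \<phi> p"
  by (simp add: ev_def \<epsilon>.pev_pCons)

lemma q_ycoord: "q \<noteq> 0 \<Longrightarrow> [:\<iota> q:] * ycoord q \<phi> = \<epsilon> \<phi>"
  by (simp add: ycoord_def \<iota>_eq_0_iff)

lemma ev_rel: "q \<noteq> 0 \<Longrightarrow> ev q \<phi> (surf_rel q \<phi>) = 0"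
  using q_ycoord[of q \<phi>] by (simp only: surf_rel_def ev.hom_simps ev_const ev_Y \<epsilon>_const) simp

text \<open>Division by \<open>\<phi>\<close> in \<open>K[X][Z]\<close>, where the quotient is multiplied by \<open>q Y\<close> instead of \<open>\<phi>\<close>. A step
  raises the degree in \<open>Y\<close>, but lowers the degrees in \<open>Z\<close> of the coefficients, so the process stops.\<close>

lemma normal_form_const:
  fixes \<phi> :: "'k::field poly poly"
  assumes monic: "lead_coeff \<phi> = 1" and pos: "0 < degree \<phi>"
  shows "\<exists>Q P'. [:c:] = surf_rel q \<phi> * Q + P' \<and> (\<forall>i. degree (coeff P' i) < degree \<phi>)"
proof (induction "degree c" arbitrary: c rule: less_induct)
  case less
  show ?case
  proof (cases "degree c < degree \<phi>")
    case True
    then have "degree (coeff [:c:] i) < degree \<phi>" for i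
      by (cases i) (use pos in auto)
    then show ?thesis by (intro exI[of _ 0] exI[of _ "[:c:]"]) auto
  next
    case False
    define m where "m = Polynomial.monom (lead_coeff c) (degree c - degree \<phi>)"
    define r where "r = c - m * \<phi>"
    have c0: "c \<noteq> 0" using False pos by auto
    have dm: "degree m = degree c - degree \<phi>"
      unfolding m_def using c0 by (intro Polynomial.degree_monom_eq) simp
    have m0: "m \<noteq> 0" using c0 by (simp add: m_def)
    have p0: "\<phi> \<noteq> 0" using pos by auto
    have dmp: "degree (m * \<phi>) = degree c"
      using dm False m0 p0 by (simp add: degree_mult_eq)
    have lm: "lead_coeff (m * \<phi>) = lead_coeff c"
      unfolding lead_coeff_mult monic m_def by (simp only: Polynomial.lead_coeff_monom mult_1_right)
    have "degree r \<le> degree c"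
      unfolding r_def by (rule degree_diff_le) (auto simp: dmp)
    moreover have "coeff r (degree c) = 0"
      unfolding r_def using lm dmp by simp
    ultimately have dr: "degree r < degree c"
      using eq_zero_or_degree_less[of r "degree c"] False pos by auto
    have ds: "degree (smult q m) < degree c"
      using dm False pos degree_smult_le[of q m] by linarith
    obtain Q1 P1 where 1: "[:r:] = surf_rel q \<phi> * Q1 + P1" "\<forall>i. degree (coeff P1 i) < degree \<phi>"
      using less[OF dr] by blast
    obtain Q2 P2 where 2: "[:smult q m:] = surf_rel q \<phi> * Q2 + P2" "\<forall>i. degree (coeff P2 i) < degree \<phi>"
      using less[OF ds] by blast
    have "[:c:] = [:r:] + [:smult q m:] * [:0, 1:] - [:m:] * surf_rel q \<phi>"
      by (simp add: r_def surf_rel_def)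
    also have "\<dots> = surf_rel q \<phi> * (Q1 + Q2 * [:0, 1:] - [:m:]) + (P1 + [:0, 1:] * P2)"
      by (simp only: 1(1) 2(1)) (simp only: algebra_simps)
    finally have "[:c:] = \<dots>" .
    moreover have "degree (coeff (P1 + [:0, 1:] * P2) i) < degree \<phi>" for i
    proof -
      have "degree (coeff ([:0, 1:] * P2) i) < degree \<phi>"
        using 2(2) pos by (cases i) auto
      then show ?thesis using 1(2) by (auto intro!: degree_add_less)
    qed
    ultimately show ?thesis by blast
  qed
qed

lemma normal_form:
  fixes \<phi> :: "'k::field poly poly"
  assumes monic: "lead_coeff \<phi> = 1" and pos: "0 < degree \<phi>"
  shows "\<exists>Q P'. P = surf_rel q \<phi> * Q + P' \<and> (\<forall>i. degree (coeff P' i) < degree \<phi>)"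
proof (induction P)
  case 0
  show ?case by (intro exI[of _ 0] exI[of _ "0"]) (use pos in auto)
next
  case (pCons a P)
  obtain Q1 P1 where 1: "[:a:] = surf_rel q \<phi> * Q1 + P1" "\<forall>i. degree (coeff P1 i) < degree \<phi>"
    using normal_form_const[OF assms] by blast
  obtain Q2 P2 where 2: "P = surf_rel q \<phi> * Q2 + P2" "\<forall>i. degree (coeff P2 i) < degree \<phi>"
    using pCons.IH by blast
  have "pCons a P = [:a:] + [:0, 1:] * P" by simp
  also have "\<dots> = surf_rel q \<phi> * (Q1 + Q2 * [:0, 1:]) + (P1 + [:0, 1:] * P2)"
    by (simp only: 1(1) 2(1)) (simp only: algebra_simps)
  finally have "pCons a P = \<dots>" .
  moreover have "degree (coeff (P1 + [:0, 1:] * P2) i) < degree \<phi>" for i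
  proof -
    have "degree (coeff ([:0, 1:] * P2) i) < degree \<phi>"
      using 2(2) pos by (cases i) auto
    then show ?thesis using 1(2) by (auto intro!: degree_add_less)
  qed
  ultimately show ?case by blast
qed

lemma normal_form_degree:
  fixes \<phi> :: "'k::field poly poly"
  assumes monic: "lead_coeff \<phi> = 1" and pos: "0 < degree \<phi>" and q: "q \<noteq> 0"
    and P: "\<And>i. degree (coeff P i) < degree \<phi>" "P \<noteq> 0"
  shows "degree (ev q \<phi> P) = degree (lead_coeff P) + degree \<phi> * degree P"
    and "lead_coeff (ev q \<phi> P) = \<iota> (lead_coeff (lead_coeff P)) * inverse (\<iota> q) ^ degree P"
    and "ev q \<phi> P \<noteq> 0"
proof -
  let ?P = "map_poly \<epsilon> P"
  have dP: "degree ?P = degree P"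
    by (rule degree_map_poly) (simp add: \<epsilon>_eq_0_iff)
  have dy: "degree (ycoord q \<phi>) = degree \<phi>"
    by (simp add: ycoord_def \<iota>_eq_0_iff q degree_\<epsilon>)
  have ly: "lead_coeff (ycoord q \<phi>) = inverse (\<iota> q)"
    by (simp add: dy) (simp add: ycoord_def coeff_\<epsilon> monic \<iota>.hom_one)
  have E: "ev q \<phi> P = poly ?P (ycoord q \<phi>)"
    by (simp add: ev_def pev_def)
  have L: "coeff ?P (degree P) = \<epsilon> (lead_coeff P)"
    by (simp add: dP \<epsilon>.coeff_hom)
  have LL: "lead_coeff (\<epsilon> (lead_coeff P)) = \<iota> (lead_coeff (lead_coeff P))"
    by (simp add: degree_\<epsilon> coeff_\<epsilon>)
  have "?P \<noteq> 0" using P(2) by (metis \<epsilon>_eq_0_iff \<epsilon>.coeff_hom leading_coeff_0_iff coeff_0)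
  then have *: "degree (poly ?P (ycoord q \<phi>)) = degree (lead_coeff ?P) + degree \<phi> * degree ?P
    \<and> lead_coeff (poly ?P (ycoord q \<phi>)) = lead_coeff (lead_coeff ?P) * lead_coeff (ycoord q \<phi>) ^ degree ?P
    \<and> poly ?P (ycoord q \<phi>) \<noteq> 0"
    by (intro degree_poly_small_coeffs dy pos) (simp_all add: \<epsilon>.coeff_hom degree_\<epsilon> P)
  from this[unfolded dP L LL ly, unfolded degree_\<epsilon>]
  show "degree (ev q \<phi> P) = degree (lead_coeff P) + degree \<phi> * degree P"
    and "lead_coeff (ev q \<phi> P) = \<iota> (lead_coeff (lead_coeff P)) * inverse (\<iota> q) ^ degree P"
    and "ev q \<phi> P \<noteq> 0"
    unfolding E degree_\<epsilon> dP L LL ly by (blast, blast, blast)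
qed

text \<open>The kernel is no larger than the ideal, because a nonzero normal form evaluates to something nonzero.\<close>

lemma ev_eq_0_iff:
  fixes \<phi> :: "'k::field poly poly"
  assumes "lead_coeff \<phi> = 1" and "0 < degree \<phi>" and "q \<noteq> 0"
  shows "ev q \<phi> P = 0 \<longleftrightarrow> surf_rel q \<phi> dvd P"
proof
  assume 0: "ev q \<phi> P = 0"
  obtain Q P' where QP: "P = surf_rel q \<phi> * Q + P'" "\<forall>i. degree (coeff P' i) < degree \<phi>"
    using normal_form[OF assms(1,2)] by blast
  have "ev q \<phi> P' = 0"
    using 0 QP(1) by (simp add: ev.hom_simps ev_rel assms)
  then have "P' = 0"
    using normal_form_degree(3)[OF assms, of P'] QP(2) by blast
  then show "surf_rel q \<phi> dvd P" using QP(1) by simp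
next
  assume "surf_rel q \<phi> dvd P"
  then show "ev q \<phi> P = 0"
    by (auto simp: ev.hom_simps ev_rel assms elim!: dvdE)
qed

lemma surf_normal_form:
  fixes \<phi> :: "'k::field poly poly"
  assumes "lead_coeff \<phi> = 1" and "0 < degree \<phi>" and "q \<noteq> 0" and "u \<in> surf q \<phi>"
  obtains P where "u = ev q \<phi> P" "\<And>i. degree (coeff P i) < degree \<phi>"
proof -
  obtain P0 where P0: "u = ev q \<phi> P0" using assms(4) by (auto simp: surf_def)
  obtain Q P where QP: "P0 = surf_rel q \<phi> * Q + P" "\<forall>i. degree (coeff P i) < degree \<phi>"
    using normal_form[OF assms(1,2)] by blast
  have "u = ev q \<phi> P"
    by (simp add: P0 QP(1) ev.hom_simps ev_rel assms)
  then show thesis using that QP(2) by blast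
qed

section \<open>From quotient rings to subrings\<close>

definition ring_on :: "'a::comm_ring_1 set \<Rightarrow> 'a ring"
  where "ring_on C = (ring_of_type_algebra :: 'a ring)\<lparr>carrier := C\<rparr>"

lemma ring_on_simps [simp]:
  "carrier (ring_on C) = C" "x \<otimes>\<^bsub>ring_on C\<^esub> y = x * y" "x \<oplus>\<^bsub>ring_on C\<^esub> y = x + y"
  "\<one>\<^bsub>ring_on C\<^esub> = 1" "\<zero>\<^bsub>ring_on C\<^esub> = 0"
  by (simp_all add: ring_on_def ring_of_type_algebra_def)

lemma type_algebra_simps [simp]:
  "carrier (ring_of_type_algebra :: 'a::ring_1 ring) = UNIV"
  "(x::'a) \<otimes>\<^bsub>ring_of_type_algebra\<^esub> y = x * y" "x \<oplus>\<^bsub>ring_of_type_algebra\<^esub> y = x + y"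
  "\<one>\<^bsub>ring_of_type_algebra\<^esub> = (1::'a)" "\<zero>\<^bsub>ring_of_type_algebra\<^esub> = (0::'a)"
  by (simp_all add: ring_of_type_algebra_def)

lemma PIdl_type_algebra: "PIdl\<^bsub>ring_of_type_algebra\<^esub> (a::'a::comm_ring_1) = {x. a dvd x}"
  by (auto simp: cgenideal_def dvd_def mult.commute)

lemma surface_ring_iso_surf:
  fixes g :: "'k::field poly"
  assumes monic: "lead_coeff \<phi> = 1" and pos: "0 < degree \<phi>" and g: "g \<noteq> 0"
  shows "alg_isomorphic (surface_ring g \<phi> n) (surface_const g \<phi> n)
    (ring_on (surf ([:0, 1:] ^ n * g) \<phi>)) (\<lambda>c. [:\<iota> [:c:]:])"
proof -
  let ?q = "[:0, 1:] ^ n * g"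
  let ?h = "ev ?q \<phi>"
  let ?T = "ring_of_type_algebra :: 'k fls poly ring"
  have q: "?q \<noteq> 0" using g by simp
  have hom: "?h \<in> ring_hom KXYZ ?T"
    by (rule ring_hom_memI) (simp_all add: ev.hom_simps)
  have h: "ring_hom_ring KXYZ ?T ?h"
    by (rule ring_hom_ringI2[OF ring_from_type_algebra ring_from_type_algebra hom])
  have ker: "a_kernel KXYZ ?T ?h = surface_ideal g \<phi> n"
    by (simp add: a_kernel_def' surface_ideal_def PIdl_type_algebra ev_eq_0_iff[OF monic pos q]
        surface_poly_def surf_rel_def)
  have "(\<lambda>U. the_elem (?h ` U)) \<in> ring_iso (KXYZ Quot a_kernel KXYZ ?T ?h) (?T\<lparr>carrier := ?h ` carrier KXYZ\<rparr>)"
    by (rule ring_hom_ring.FactRing_iso_set_aux[OF h])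
  then have "(\<lambda>U. the_elem (?h ` U)) \<in> ring_iso (surface_ring g \<phi> n) (ring_on (surf ?q \<phi>))"
    by (simp add: ker surface_ring_def ring_on_def surf_def)
  moreover have "the_elem (?h ` surface_const g \<phi> n c) = [:\<iota> [:c:]:]" for c
    using ring_hom_ring.the_elem_simp[OF h, of "[:[:[:c:]:]:]"]
    by (simp add: ker surface_const_def ev_const \<epsilon>_const)
  ultimately show ?thesis unfolding alg_isomorphic_def
    by (intro bexI[of _ "\<lambda>U. the_elem (?h ` U)"]) simp_all
qed

lemma alg_isomorphic_sym:
  assumes "ring A" "\<And>c. \<iota>A c \<in> carrier A" and "alg_isomorphic A \<iota>A B \<iota>B"
  shows "alg_isomorphic B \<iota>B A \<iota>A"
proof -
  obtain h where h: "h \<in> ring_iso A B" "\<And>c. h (\<iota>A c) = \<iota>B c"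
    using assms(3) by (auto simp: alg_isomorphic_def)
  have "inv_into (carrier A) h \<in> ring_iso B A"
    by (rule ring_iso_set_sym[OF assms(1) h(1)])
  moreover have "inv_into (carrier A) h (\<iota>B c) = \<iota>A c" for c
    using h assms(2)[of c] by (metis inv_into_f_f bij_betw_imp_inj_on ring_iso_memE(5))
  ultimately show ?thesis by (auto simp: alg_isomorphic_def)
qed

lemma alg_isomorphic_trans:
  assumes "alg_isomorphic A \<iota>A B \<iota>B" "alg_isomorphic B \<iota>B C \<iota>C"
  shows "alg_isomorphic A \<iota>A C \<iota>C"
proof -
  obtain h k where h: "h \<in> ring_iso A B" "\<And>c. h (\<iota>A c) = \<iota>B c"
    and k: "k \<in> ring_iso B C" "\<And>c. k (\<iota>B c) = \<iota>C c"
    using assms by (auto simp: alg_isomorphic_def)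
  have "k \<circ> h \<in> ring_iso A C" by (rule ring_iso_set_trans[OF h(1) k(1)])
  then show ?thesis unfolding alg_isomorphic_def
    by (intro bexI[of _ "k \<circ> h"]) (simp_all add: h(2) k(2))
qed

section \<open>Polynomial rings over subrings\<close>

definition polyset :: "'a::comm_ring_1 set \<Rightarrow> 'a poly set"
  where "polyset C = {p. \<forall>i. coeff p i \<in> C}"

text \<open>This moves the second half of the theorem from \<open>UP\<close> over a quotient ring into \<open>F[Z][T]\<close>, where
  automorphisms can be written as substitutions.\<close>

lemma UP_alg_isomorphic:
  fixes A (structure) and C :: "'b::comm_ring_1 set"
  assumes A: "ring A" and const: "\<And>c. \<iota>A c \<in> carrier A"
    and iso: "alg_isomorphic A \<iota>A (ring_on C) \<kappa>"
  shows "alg_isomorphic (UP A) (up_const A \<iota>A) (ring_on (polyset C)) (\<lambda>c. [:\<kappa> c:])"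
proof -
  interpret A: ring A by fact
  obtain h where h: "h \<in> ring_iso A (ring_on C)" and hc: "\<And>c. h (\<iota>A c) = \<kappa> c"
    using iso by (auto simp: alg_isomorphic_def)
  have bij: "bij_betw h (carrier A) C"
    using ring_iso_memE(5)[OF h] by simp
  have add: "h (x \<oplus> y) = h x + h y" and mult: "h (x \<otimes> y) = h x * h y"
    if "x \<in> carrier A" "y \<in> carrier A" for x y
    using ring_iso_memE(2,3)[OF h that] by simp_all
  have one: "h \<one> = 1" using ring_iso_memE(4)[OF h] by simp
  have zero: "h \<zero> = 0"
    using add[of \<zero> \<zero>] by simp
  have mem: "h x \<in> C" if "x \<in> carrier A" for x
    using bij that by (auto simp: bij_betw_def)
  have inj: "x = y" if "x \<in> carrier A" "y \<in> carrier A" "h x = h y" for x y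
    using bij that by (auto simp: bij_betw_def inj_on_def)
  have fsum: "h (finsum A f {..n}) = (\<Sum>i\<le>n. h (f i))" if "f \<in> {..n} \<rightarrow> carrier A" for f and n :: nat
    using that
  proof (induction n)
    case (Suc n)
    then have "f \<in> {..n} \<rightarrow> carrier A" by auto
    with Suc show ?case
      by (simp add: add add.commute Pi_iff)
  qed simp
  let ?H = "\<lambda>p. Abs_poly (\<lambda>i. h (p i))"
  have coeff: "coeff (?H p) i = h (p i)" if p: "p \<in> up A" for p i
  proof -
    obtain n where "bound \<zero> n p" using p by (auto simp: up_def)
    then have "\<forall>i>n. h (p i) = 0" by (auto simp: bound_def zero)
    then have "\<forall>\<^sub>\<infinity>i. h (p i) = 0" by (auto simp: MOST_nat)
    then show ?thesis by (simp add: Abs_poly_inverse)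
  qed
  have closed: "p i \<in> carrier A" if "p \<in> up A" for p i
    using that by (auto simp: up_def)
  have "?H \<in> ring_iso (UP A) (ring_on (polyset C))"
  proof (rule ring_iso_memI)
    fix p q assume "p \<in> carrier (UP A)" "q \<in> carrier (UP A)"
    then have p: "p \<in> up A" and q: "q \<in> up A" by (simp_all add: UP_def)
    show "?H p \<in> carrier (ring_on (polyset C))"
      by (simp add: polyset_def coeff p mem closed)
    have pq: "(\<lambda>n. \<Oplus>i\<in>{..n}. p i \<otimes> q (n - i)) \<in> up A" "(\<lambda>i. p i \<oplus> q i) \<in> up A"
      using A.up_mult_closed[OF p q] A.up_add_closed[OF p q] by simp_all
    show "?H (p \<otimes>\<^bsub>UP A\<^esub> q) = ?H p \<otimes>\<^bsub>ring_on (polyset C)\<^esub> ?H q"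
    proof (simp, rule poly_eqI)
      fix n
      have m: "p \<otimes>\<^bsub>UP A\<^esub> q = (\<lambda>n. \<Oplus>i\<in>{..n}. p i \<otimes> q (n - i))"
        by (simp add: UP_def p q)
      have "coeff (?H (p \<otimes>\<^bsub>UP A\<^esub> q)) n = h (\<Oplus>i\<in>{..n}. p i \<otimes> q (n - i))"
        unfolding m by (rule coeff[OF pq(1)])
      also have "\<dots> = (\<Sum>i\<le>n. h (p i) * h (q (n - i)))"
        by (subst fsum) (auto simp: closed p q mult)
      finally show "coeff (?H (p \<otimes>\<^bsub>UP A\<^esub> q)) n = coeff (?H p * ?H q) n"
        by (simp add: coeff_mult coeff p q)
    qed
    show "?H (p \<oplus>\<^bsub>UP A\<^esub> q) = ?H p \<oplus>\<^bsub>ring_on (polyset C)\<^esub> ?H q"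
    proof (simp, rule poly_eqI)
      fix n
      have m: "p \<oplus>\<^bsub>UP A\<^esub> q = (\<lambda>i. p i \<oplus> q i)"
        by (simp add: UP_def p q)
      have "coeff (?H (p \<oplus>\<^bsub>UP A\<^esub> q)) n = h (p n \<oplus> q n)"
        unfolding m by (rule coeff[OF pq(2)])
      then show "coeff (?H (p \<oplus>\<^bsub>UP A\<^esub> q)) n = coeff (?H p + ?H q) n"
        by (simp add: coeff p q add closed)
    qed
  next
    have m: "\<one>\<^bsub>UP A\<^esub> = (\<lambda>i. if i = 0 then \<one> else \<zero>)"
      by (simp add: UP_def)
    show "?H \<one>\<^bsub>UP A\<^esub> = \<one>\<^bsub>ring_on (polyset C)\<^esub>"
    proof (simp, rule poly_eqI)
      fix n
      show "coeff (?H \<one>\<^bsub>UP A\<^esub>) n = coeff 1 n"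
        unfolding m by (subst coeff) (auto simp: one zero A.up_one_closed)
    qed
  next
    show "bij_betw ?H (carrier (UP A)) (carrier (ring_on (polyset C)))"
    proof (rule bij_betwI')
      fix p q assume "p \<in> carrier (UP A)" "q \<in> carrier (UP A)"
      then have p: "p \<in> up A" and q: "q \<in> up A" by (simp_all add: UP_def)
      show "?H p = ?H q \<longleftrightarrow> p = q"
        using coeff[OF p] coeff[OF q] inj closed p q by (metis ext)
    next
      fix p assume "p \<in> carrier (UP A)"
      then show "?H p \<in> carrier (ring_on (polyset C))"
        by (simp add: polyset_def coeff mem closed UP_def)
    next
      fix P assume "P \<in> carrier (ring_on (polyset C))"
      then have P: "coeff P i \<in> C" for i by (simp add: polyset_def)
      define p where "p = (\<lambda>i. inv_into (carrier A) h (coeff P i))"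
      have hp: "h (p i) = coeff P i" "p i \<in> carrier A" for i
        using P[of i] bij unfolding p_def
        by (auto simp: bij_betw_def f_inv_into_f inv_into_into)
      have "p i = \<zero>" if "degree P < i" for i
        using hp[of i] zero that by (intro inj) (simp_all add: coeff_eq_0)
      then have "p \<in> up A" using hp by (auto simp: up_def bound_def)
      have "P = ?H p"
        by (rule poly_eqI) (rule sym[OF trans[OF coeff[OF \<open>p \<in> up A\<close>] hp(1)]])
      moreover have "p \<in> carrier (UP A)" using \<open>p \<in> up A\<close> by (simp add: UP_def)
      ultimately show "\<exists>p\<in>carrier (UP A). P = ?H p" by blast
    qed
  qed
  moreover have "?H (up_const A \<iota>A c) = [:\<kappa> c:]" for c
  proof (rule poly_eqI)
    fix n
    have m: "up_const A \<iota>A c = (\<lambda>i. if i = 0 then \<iota>A c else \<zero>)"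
      by (simp add: up_const_def UP_def const)
    have "up_const A \<iota>A c \<in> up A"
      by (auto simp: m up_def const bound_def intro!: exI[of _ 0])
    then show "coeff (?H (up_const A \<iota>A c)) n = coeff [:\<kappa> c:] n"
      by (simp add: coeff) (simp add: m hc zero coeff_pCons split: nat.splits)
  qed
  ultimately show ?thesis unfolding alg_isomorphic_def
    by (intro bexI[of _ ?H]) simp_all
qed

section \<open>Stable isomorphism\<close>

definition ring_closed :: "'a::comm_ring_1 set \<Rightarrow> bool"
  where "ring_closed S \<longleftrightarrow> 1 \<in> S \<and> (\<forall>a\<in>S. \<forall>b\<in>S. a - b \<in> S \<and> a * b \<in> S)"

lemma ring_closedD:
  assumes "ring_closed S"
  shows "0 \<in> S" "1 \<in> S" "a \<in> S \<Longrightarrow> b \<in> S \<Longrightarrow> a - b \<in> S" "a \<in> S \<Longrightarrow> b \<in> S \<Longrightarrow> a * b \<in> S"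
    "a \<in> S \<Longrightarrow> - a \<in> S" "a \<in> S \<Longrightarrow> b \<in> S \<Longrightarrow> a + b \<in> S" "a \<in> S \<Longrightarrow> a ^ n \<in> S"
proof -
  show one: "1 \<in> S" and diff: "a \<in> S \<Longrightarrow> b \<in> S \<Longrightarrow> a - b \<in> S"
    and mult: "a \<in> S \<Longrightarrow> b \<in> S \<Longrightarrow> a * b \<in> S" for a b
    using assms by (auto simp: ring_closed_def)
  show zero: "0 \<in> S" using diff[OF one one] by simp
  show um: "a \<in> S \<Longrightarrow> - a \<in> S" for a using diff[OF zero, of a] by simp
  show "a \<in> S \<Longrightarrow> b \<in> S \<Longrightarrow> a + b \<in> S" using diff[OF _ um, of a b] by simp
  show "a \<in> S \<Longrightarrow> a ^ n \<in> S" by (induction n) (auto intro: one mult)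
qed

lemma (in rhom) ring_closed_range: "ring_closed (range f)"
  unfolding ring_closed_def
  by (auto simp flip: hom_one hom_diff hom_mult)

lemma polyset_range:
  assumes "rhom f" shows "polyset (range f) = range (map_poly f)"
proof -
  interpret rhom f by fact
  have "p \<in> range (map_poly f)" if "\<forall>i. coeff p i \<in> range f" for p
    using that
  proof (induction p)
    case 0
    then show ?case by (metis map_poly_0 rangeI)
  next
    case (pCons a p)
    have "coeff p i \<in> range f" for i using pCons.prems[rule_format, of "Suc i"] by simp
    with pCons.IH obtain P where P: "p = map_poly f P" by blast
    obtain b where "a = f b" using pCons.prems[rule_format, of 0] by auto
    then have "pCons a p = map_poly f (pCons b P)"
      by (simp add: P map_poly_pCons')
    then show ?case by blast
  qed
  then show ?thesis by (auto simp: polyset_def coeff_hom)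
qed

lemma rhom_poly_mem:
  assumes H: "rhom H" and S: "ring_closed S" and "\<And>c. H [:c:] \<in> S" and "H [:0, 1:] \<in> S"
  shows "H p \<in> S"
proof (induction p)
  case 0
  then show ?case using assms(3)[of 0] by simp
next
  case (pCons a p)
  have "pCons a p = [:a:] + [:0, 1:] * p" by simp
  then have "H (pCons a p) = H [:a:] + H [:0, 1:] * H p"
    by (metis rhom.hom_add[OF H] rhom.hom_mult[OF H])
  then show ?case using pCons.IH assms by (auto intro: ring_closedD)
qed

lemma pev_mem:
  assumes "rhom c" "ring_closed S" "\<And>r. c r \<in> S" "z \<in> S"
  shows "pev c z p \<in> S"
  by (rule rhom_poly_mem[of "pev c z"])
    (use assms in \<open>auto simp: rhom.rhom_pev rhom.pev_const rhom.pev_X\<close>)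

text \<open>The remainder is kept inside a given subring, which is what divisibility arguments in the
  cylinders need.\<close>

lemma taylor_second_order:
  assumes c: "rhom c" and S: "ring_closed S" "\<And>r. c r \<in> S" "z \<in> S" "h \<in> S"
  shows "\<exists>\<rho>\<in>S. pev c (z + h) p = pev c z p + h * pev c z (pderiv p) + h ^ 2 * \<rho>"
proof (induction p)
  case 0
  then show ?case using S by (auto intro!: bexI[of _ 0] ring_closedD)
next
  case (pCons a p)
  interpret c: rhom c by fact
  interpret ev: rhom "pev c z" by (rule c.rhom_pev)
  from pCons.IH obtain \<rho> where \<rho>: "\<rho> \<in> S"
    "pev c (z + h) p = pev c z p + h * pev c z (pderiv p) + h ^ 2 * \<rho>" by blast
  have "pev c z (pderiv p) \<in> S" by (rule pev_mem) (use assms in auto)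
  then have "pev c z (pderiv p) + z * \<rho> + h * \<rho> \<in> S"
    using S \<rho> by (auto intro!: ring_closedD)
  moreover have "pev c (z + h) (pCons a p) = pev c z (pCons a p)
    + h * pev c z (pderiv (pCons a p)) + h ^ 2 * (pev c z (pderiv p) + z * \<rho> + h * \<rho>)"
    by (simp only: c.pev_pCons \<rho> pderiv_pCons ev.hom_add c.hom_zero)
      (simp add: algebra_simps power2_eq_square)
  ultimately show ?case by blast
qed

text \<open>In \<open>F[Z][T]\<close> the variable \<open>Z\<close> is \<open>[:[:0, 1:]:]\<close> and \<open>T\<close> is \<open>[:0, 1:]\<close>.\<close>

definition cc :: "'k::field poly \<Rightarrow> 'k fls poly poly" where "cc r = [:[:\<iota> r:]:]"

definition subst2 :: "'k::field fls poly poly \<Rightarrow> 'k fls poly poly \<Rightarrow> 'k fls poly poly \<Rightarrow> 'k fls poly poly"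
  where "subst2 a b = pev (pev (\<lambda>c. [:[:c:]:]) a) b"

lemma rhom_cc0: "rhom (\<lambda>c. [:[:c:]:])"
  by (rule rhom_comp[OF rhom_const rhom_const])

interpretation cc0: rhom "\<lambda>c::'a::comm_ring_1. [:[:c:]:]" by (rule rhom_cc0)

lemma rhom_cc: "rhom cc"
  unfolding cc_def by (rule rhom_comp[OF rhom_\<iota> rhom_cc0])

interpretation cc: rhom cc by (rule rhom_cc)

lemma rhom_subst2: "rhom (subst2 a b)"
  unfolding subst2_def by (intro rhom.rhom_pev rhom_cc0)

interpretation subst2: rhom "subst2 a b" for a b by (rule rhom_subst2)

lemma subst2_simps:
  "subst2 a b [:[:c:]:] = [:[:c:]:]" "subst2 a b [:[:0, 1:]:] = a" "subst2 a b [:0, 1:] = b"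
  "subst2 a b (cc r) = cc r" "subst2 a b [:\<epsilon> p:] = pev cc a p"
proof -
  note * = rhom.rhom_pev[OF rhom_cc0, of a]
  show "subst2 a b [:[:c:]:] = [:[:c:]:]" for c
    by (simp add: subst2_def rhom.pev_const[OF *] cc0.pev_const)
  show "subst2 a b [:[:0, 1:]:] = a" "subst2 a b [:0, 1:] = b"
    by (simp_all add: subst2_def rhom.pev_const[OF *] cc0.pev_X rhom.pev_X[OF *])
  show "subst2 a b (cc r) = cc r"
    by (simp add: cc_def subst2_def rhom.pev_const[OF *] cc0.pev_const)
  show "subst2 a b [:\<epsilon> p:] = pev cc a p"
    by (simp add: subst2_def rhom.pev_const[OF *] \<epsilon>_def \<iota>.pev_map_poly[OF rhom_cc0] cc_def[abs_def])
qed

lemma const_eq_pev: "[:\<epsilon> p:] = pev cc [:[:0, 1:]:] p"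
proof -
  have "rhom (\<lambda>p. [:\<epsilon> p:])" by (rule rhom_comp[OF rhom_\<epsilon> rhom_const])
  from rhom_eq_pev[OF this] show ?thesis
    by (simp add: \<epsilon>_const cc_def[abs_def] \<epsilon>_pCons \<iota>.hom_zero \<iota>.hom_one \<epsilon>.hom_zero)
qed

lemma subst2_id:
  assumes "rhom H" "\<And>c. H [:[:c:]:] = [:[:c:]:]" "H [:[:0, 1:]:] = [:[:0, 1:]:]" "H [:0, 1:] = [:0, 1:]"
  shows "H p = p"
proof -
  have "H [:u:] = [:u:]" for u
  proof -
    have 1: "rhom (\<lambda>u. H [:u:])" by (rule rhom_comp[OF rhom_const assms(1)])
    from rhom_eq_pev[OF 1, of u] rhom_eq_pev[OF rhom_const, of u]
    show ?thesis by (simp only: assms)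
  qed
  moreover have "rhom (\<lambda>p::'a poly poly. p)" by (simp add: rhom_def)
  ultimately show ?thesis
    using rhom_eq_pev[OF assms(1), of p] rhom_eq_pev[of "\<lambda>p. p" p] assms(4) by simp
qed

abbreviation cylinder :: "'k::field poly \<Rightarrow> 'k poly poly \<Rightarrow> 'k fls poly poly set"
  where "cylinder q \<phi> \<equiv> polyset (surf q \<phi>)"

lemma cyl_eq_range: "cylinder q \<phi> = range (map_poly (ev q \<phi>))"
  unfolding surf_def by (rule polyset_range[OF rhom_ev])

lemma ring_closed_cyl: "ring_closed (cylinder q \<phi>)"
  unfolding cyl_eq_range by (intro rhom.ring_closed_range rhom.rhom_map_poly rhom_ev)

lemma cyl_gens:
  "cc r \<in> cylinder q \<phi>" "[:[:0, 1:]:] \<in> cylinder q \<phi>" "[:0, 1:] \<in> cylinder q \<phi>" "[:ycoord q \<phi>:] \<in> cylinder q \<phi>"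
proof -
  have "cc r = map_poly (ev q \<phi>) [:[:[:r:]:]:]"
    by (simp add: ev.map_poly_pCons' ev_const \<epsilon>_const cc_def)
  moreover have "[:[:0, 1:]:] = map_poly (ev q \<phi>) [:[:[:0, 1:]:]:]"
    by (simp add: ev.map_poly_pCons' ev_const \<epsilon>_pCons \<iota>.hom_zero \<iota>.hom_one \<epsilon>.hom_zero)
  moreover have "[:0, 1:] = map_poly (ev q \<phi>) [:0, 1:]"
    by (simp add: ev.map_poly_pCons' ev.hom_zero ev.hom_one)
  moreover have "[:ycoord q \<phi>:] = map_poly (ev q \<phi>) [:[:0, 1:]:]"
    by (simp add: ev.map_poly_pCons' ev_Y)
  ultimately show "cc r \<in> cylinder q \<phi>" "[:[:0, 1:]:] \<in> cylinder q \<phi>" "[:0, 1:] \<in> cylinder q \<phi>" "[:ycoord q \<phi>:] \<in> cylinder q \<phi>"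
    unfolding cyl_eq_range by (metis rangeI)+
qed

text \<open>To map a cylinder into a subring it suffices to map \<open>K[X]\<close>, \<open>Z\<close>, \<open>T\<close> and \<open>Y\<close> into it.\<close>

lemma cyl_hom_mem:
  assumes H: "rhom H" and S: "ring_closed S" and "p \<in> cylinder q \<phi>"
    and "\<And>r. H (cc r) \<in> S" "H [:[:0, 1:]:] \<in> S" "H [:0, 1:] \<in> S" "H [:ycoord q \<phi>:] \<in> S"
  shows "H p \<in> S"
proof -
  obtain P where P: "p = map_poly (ev q \<phi>) P" using assms(3) by (auto simp: cyl_eq_range)
  have 4: "rhom (\<lambda>P. H (map_poly (ev q \<phi>) P))"
    by (rule rhom_comp[OF ev.rhom_map_poly H])
  have 3: "rhom (\<lambda>P. H (map_poly (ev q \<phi>) [:P:]))"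
    by (rule rhom_comp[OF rhom_const 4])
  have 2: "rhom (\<lambda>P. H (map_poly (ev q \<phi>) [:[:P:]:]))"
    by (rule rhom_comp[OF rhom_const 3])
  have "H (map_poly (ev q \<phi>) P) \<in> S"
    apply (rule rhom_poly_mem[OF 4 S])
     apply (rule rhom_poly_mem[OF 3 S])
      apply (rule rhom_poly_mem[OF 2 S])
    using assms
    by (simp_all add: ev.map_poly_pCons' ev_const \<epsilon>_const cc_def ev_Y \<epsilon>_pCons \<iota>.hom_zero \<iota>.hom_one
        \<epsilon>.hom_zero ev.hom_zero ev.hom_one)
  then show ?thesis by (simp add: P)
qed

lemma cc_ycoord: "q \<noteq> 0 \<Longrightarrow> cc q * [:ycoord q \<phi>:] = [:\<epsilon> \<phi>:]"
  using q_ycoord[of q \<phi>] by (simp add: cc_def)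

text \<open>The next two identities are the Newton steps of \<open>cylinder_isomorphic\<close>. The hypothesis is the relation
  \<open>\<alpha> \<phi> + \<beta> \<phi>\<^sub>Z = 1\<close> times \<open>Y\<close> or \<open>T\<close>, with \<open>\<phi>\<close> replaced by its multiple of \<open>Y\<close>; it turns the part that is
  not visibly divisible by \<open>P\<close> into a multiple of \<open>P\<close>.\<close>

lemma forward_identity:
  fixes Y :: "'a::comm_ring_1"
  assumes "Y = Y * (A * (P * R * Y) + B * D)"
  shows "Y - (B * Y - P * T) * D + P * R * (B * Y - P * T)\<^sup>2 * \<rho> =
    P * (R * A * Y\<^sup>2 + T * D + R * (B * Y - P * T)\<^sup>2 * \<rho>)"
proof -
  have "Y - B * Y * D = P * R * A * Y\<^sup>2"
    using assms by (simp add: algebra_simps power2_eq_square)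
  then show ?thesis by (simp add: algebra_simps)
qed

lemma backward_identity:
  fixes Y :: "'a::comm_ring_1"
  assumes "T = T * (A * (P * (P * R) * Y) + B * D)"
  shows "P * (B * Y - A * (P * R) * Y * T + B * R * T\<^sup>2 * \<rho>
      + R * T * \<sigma> * (P * Y + T * D + P * R * T\<^sup>2 * \<rho>))
    = (B + P * R * T * \<sigma>) * (P * Y + T * D + P * R * T\<^sup>2 * \<rho>) - T"
proof -
  have "B * T * D - T = - (P * (A * (P * R) * Y * T))"
    using assms by (simp add: algebra_simps)
  then show ?thesis by (simp add: algebra_simps)
qed

text \<open>Write \<open>Y\<close> for \<open>\<phi>/q\<close> and \<open>Y'\<close> for \<open>\<phi>/(p q)\<close>. The substitution \<open>f\<close> sends \<open>T\<close> to \<open>U = \<beta> Y - p T\<close> and \<open>Z\<close> to \<open>Z - q U\<close>.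
  By Taylor expansion \<open>\<phi>(Z - q U)\<close> is \<open>q (Y - U \<phi>\<^sub>Z)\<close> modulo \<open>p q\<close> times the cylinder, and \<open>Y - U \<phi>\<^sub>Z\<close> is a multiple of \<open>p\<close>
  because \<open>\<beta> \<phi>\<^sub>Z\<close> is \<open>1\<close> modulo \<open>q\<close>; thus \<open>f\<close> maps \<open>Y'\<close> into the cylinder of \<open>q\<close>. The inverse sends
  \<open>Z\<close> to \<open>Z + q T\<close> and \<open>T\<close> to the solution \<open>W\<close> of \<open>T = \<beta>(Z + q T) y - p W\<close>, where \<open>y\<close> is the image
  of \<open>Y\<close>. That \<open>p\<close> divides \<open>q\<close> is used to see that both images stay in the cylinders.\<close>

lemma cylinder_isomorphic:
  fixes \<phi> :: "'k::field poly poly"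
  assumes bez: "\<alpha> * \<phi> + \<beta> * pderiv \<phi> = 1" and p0: "p \<noteq> 0" and r0: "r \<noteq> 0"
  defines "q \<equiv> p * r"
  shows "alg_isomorphic (ring_on (cylinder (p * q) \<phi>)) (\<lambda>c. [:[:\<iota> [:c:]:]:])
    (ring_on (cylinder q \<phi>)) (\<lambda>c. [:[:\<iota> [:c:]:]:])"
proof -
  have q0: "q \<noteq> 0" "p * q \<noteq> 0" using p0 r0 by (simp_all add: q_def)
  let ?Z = "[:[:0, 1:]:] :: 'k fls poly poly" and ?T = "[:0, 1:] :: 'k fls poly poly"
  let ?S = "cylinder q \<phi>" and ?S' = "cylinder (p * q) \<phi>"
  define P Q R Y Y' where "P = cc p" and "Q = cc q" and "R = cc r"
    and "Y = [:ycoord q \<phi>:]" and "Y' = [:ycoord (p * q) \<phi>:]"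
  define A B D where "A = pev cc ?Z \<alpha>" and "B = pev cc ?Z \<beta>" and "D = pev cc ?Z (pderiv \<phi>)"
  define F where "F = [:\<epsilon> \<phi>:]"
  note S = ring_closedD[OF ring_closed_cyl]
  have nz: "P \<noteq> 0" "Q \<noteq> 0" using p0 q0 by (simp_all add: P_def Q_def cc_def \<iota>_eq_0_iff)
  have QPR: "Q = P * R" by (simp add: Q_def P_def R_def q_def cc.hom_mult)
  have QY: "Q * Y = F" using cc_ycoord[OF q0(1)] by (simp add: Q_def Y_def F_def)
  have PQY: "P * Q * Y' = F" using cc_ycoord[OF q0(2)] by (simp add: P_def Q_def Y'_def F_def cc.hom_mult)
  have F: "pev cc ?Z \<phi> = F" by (simp add: F_def const_eq_pev)
  have ABD: "A * F + B * D = 1"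
    using arg_cong[OF bez, of "pev cc ?Z"]
    by (simp add: rhom.hom_simps[OF cc.rhom_pev] A_def B_def D_def F)
  have mem: "A \<in> cylinder s \<phi>" "B \<in> cylinder s \<phi>" "D \<in> cylinder s \<phi>" "P \<in> cylinder s \<phi>" "Q \<in> cylinder s \<phi>" "R \<in> cylinder s \<phi>"
    "?Z \<in> cylinder s \<phi>" "?T \<in> cylinder s \<phi>" for s
    unfolding A_def B_def D_def P_def Q_def R_def
    by (auto intro!: pev_mem ring_closed_cyl cyl_gens rhom_cc)
  have Ymem: "Y \<in> ?S" "Y' \<in> ?S'" unfolding Y_def Y'_def by (auto intro: cyl_gens)

  define U where "U = B * Y - P * ?T"
  have Umem: "U \<in> ?S" unfolding U_def by (intro S mem Ymem)
  obtain \<rho> where \<rho>: "\<rho> \<in> ?S" "pev cc (?Z + - (Q * U)) \<phi> = F + - (Q * U) * D + (- (Q * U)) ^ 2 * \<rho>"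
    using taylor_second_order[OF rhom_cc ring_closed_cyl cyl_gens(1) cyl_gens(2), of "- (Q * U)" q \<phi> \<phi>]
      S(5)[OF S(4)[OF mem(5) Umem]] by (auto simp: F D_def)
  define f where "f = subst2 (?Z - Q * U) U"
  have "rhom f" unfolding f_def by (rule rhom_subst2)
  interpret f: rhom f by fact
  define V where "V = R * A * Y ^ 2 + ?T * D + R * U ^ 2 * \<rho>"
  have Vmem: "V \<in> ?S" unfolding V_def by (intro S mem Ymem Umem \<rho>)
  have fY': "f Y' = V"
  proof -
    have "P * Q * f Y' = f F"
      using arg_cong[OF PQY, of f] by (simp add: f.hom_simps) (simp add: f_def P_def Q_def subst2_simps)
    also have "\<dots> = pev cc (?Z + - (Q * U)) \<phi>"
      by (simp add: f_def F_def subst2_simps)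
    also have "\<dots> = Q * (Y - U * D + Q * U ^ 2 * \<rho>)"
      unfolding \<rho>(2) QY[symmetric] by (simp add: algebra_simps power2_eq_square)
    also have "Y - U * D + Q * U ^ 2 * \<rho> = P * V"
    proof -
      have "Y = Y * (A * (Q * Y) + B * D)" using ABD QY by simp
      from this[unfolded QPR] show ?thesis unfolding U_def V_def QPR by (rule forward_identity)
    qed
    finally have "P * Q * f Y' = P * Q * V" by (simp add: mult_ac)
    then show ?thesis using nz by simp
  qed

  define a where "a = ?Z + Q * ?T"
  have QT: "Q * ?T \<in> ?S'" by (intro S mem)
  obtain \<rho>' where \<rho>': "\<rho>' \<in> ?S'" "pev cc a \<phi> = F + (Q * ?T) * D + (Q * ?T) ^ 2 * \<rho>'"
    using taylor_second_order[OF rhom_cc ring_closed_cyl cyl_gens(1) cyl_gens(2) QT, of \<phi>]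
    by (auto simp: F D_def a_def)
  obtain \<sigma>0 where \<sigma>0: "\<sigma>0 \<in> ?S'" "pev cc a \<beta> = B + (Q * ?T) * pev cc ?Z (pderiv \<beta>) + (Q * ?T) ^ 2 * \<sigma>0"
    using taylor_second_order[OF rhom_cc ring_closed_cyl cyl_gens(1) cyl_gens(2) QT, of \<beta>]
    by (auto simp: B_def a_def)
  define \<sigma> where "\<sigma> = pev cc ?Z (pderiv \<beta>) + Q * ?T * \<sigma>0"
  have "pev cc ?Z (pderiv \<beta>) \<in> ?S'"
    by (rule pev_mem) (simp_all add: rhom_cc ring_closed_cyl cyl_gens)
  then have "\<sigma> \<in> ?S'"
    unfolding \<sigma>_def by (intro S mem \<sigma>0)
  moreover have "pev cc a \<beta> = B + Q * ?T * \<sigma>"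
    unfolding \<sigma>_def \<sigma>0(2) by (simp only: power2_eq_square distrib_left mult_ac add_ac)
  ultimately have \<sigma>: "\<sigma> \<in> ?S'" "pev cc a \<beta> = B + Q * ?T * \<sigma>" by blast+
  define y where "y = P * Y' + ?T * D + Q * ?T ^ 2 * \<rho>'"
  have ymem: "y \<in> ?S'" unfolding y_def by (intro S mem Ymem \<rho>')
  have Qy: "pev cc a \<phi> = Q * y"
    unfolding \<rho>'(2) y_def PQY[symmetric] by (simp add: algebra_simps power2_eq_square)
  define W where "W = B * Y' - A * Q * Y' * ?T + B * R * ?T ^ 2 * \<rho>' + R * ?T * \<sigma> * y"
  have Wmem: "W \<in> ?S'" unfolding W_def by (intro S mem Ymem \<rho>' \<sigma> ymem)
  have PW: "P * W = pev cc a \<beta> * y - ?T"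
  proof -
    have "?T = ?T * (A * (P * Q * Y') + B * D)" using ABD PQY by simp
    from this[unfolded QPR] show ?thesis unfolding W_def \<sigma>(2) y_def QPR by (rule backward_identity)
  qed
  define k where "k = subst2 a W"
  have "rhom k" unfolding k_def by (rule rhom_subst2)
  interpret k: rhom k by fact
  have kY: "k Y = y"
  proof -
    have "Q * k Y = k F"
      using arg_cong[OF QY, of k] by (simp add: k.hom_simps) (simp add: k_def Q_def subst2_simps)
    also have "\<dots> = Q * y" by (simp add: k_def F_def subst2_simps Qy)
    finally show ?thesis using nz by simp
  qed

  have kf: "k (f u) = u" for u
  proof (rule subst2_id[of "\<lambda>u. k (f u)"])
    have "k U = k B * k Y - k P * k ?T"
      unfolding U_def by (simp only: k.hom_simps)
    also have "k B = pev cc a \<beta>"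
      by (simp add: k_def B_def subst2_simps subst2.hom_pev[OF rhom_cc])
    also have "k P = P" by (simp add: k_def P_def subst2_simps)
    also have "k ?T = W" by (simp add: k_def subst2_simps)
    finally have kU: "k U = ?T" unfolding PW kY by simp
    show "rhom (\<lambda>u. k (f u))" by (rule rhom_comp) fact+
    show "k (f [:[:c:]:]) = [:[:c:]:]" for c by (simp add: k_def f_def subst2_simps)
    show "k (f ?T) = ?T" using kU by (simp add: f_def subst2_simps)
    show "k (f ?Z) = ?Z"
      by (simp add: f_def subst2_simps k.hom_simps kU) (simp add: k_def subst2_simps a_def Q_def)
  qed
  have fk: "f (k u) = u" for u
  proof (rule subst2_id[of "\<lambda>u. f (k u)"])
    have fa: "f a = ?Z"
    proof -
      have "f a = f ?Z + f Q * f ?T" unfolding a_def by (simp only: f.hom_simps)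
      also have "\<dots> = ?Z - Q * U + Q * U" by (simp only: f_def subst2_simps Q_def)
      finally show ?thesis by simp
    qed
    have fev: "f (pev cc a p) = pev cc ?Z p" for p
      by (simp add: f.hom_pev[OF rhom_cc] fa) (simp add: f_def subst2_simps)
    have fQ: "f Q = Q" "f P = P" by (simp_all add: f_def Q_def P_def subst2_simps)
    have "Q * f y = Q * Y"
      using arg_cong[OF Qy, of f] by (simp add: fev F QY f.hom_mult fQ)
    then have fy: "f y = Y" using nz by simp
    have "P * f W = f (pev cc a \<beta>) * f y - f ?T"
      using arg_cong[OF PW, of f] by (simp only: f.hom_simps fQ)
    also have "\<dots> = B * Y - U" by (simp only: fev fy B_def) (simp only: f_def subst2_simps)
    finally have "P * f W = P * ?T" by (simp only: U_def) simp
    then have fW: "f W = ?T" by (rule mult_left_cancel[OF nz(1), THEN iffD1])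
    show "rhom (\<lambda>u. f (k u))" by (rule rhom_comp) fact+
    show "f (k [:[:c:]:]) = [:[:c:]:]" for c by (simp add: k_def f_def subst2_simps)
    show "f (k ?T) = ?T" using fW by (simp add: k_def subst2_simps)
    show "f (k ?Z) = ?Z" using fa by (simp add: k_def subst2_simps)
  qed
  have fmem: "f u \<in> ?S" if "u \<in> ?S'" for u
    by (rule cyl_hom_mem[OF \<open>rhom f\<close> ring_closed_cyl that])
      (use fY' Vmem in \<open>auto simp: f_def subst2_simps Y'_def intro!: cyl_gens S mem Umem\<close>)
  have amem: "a \<in> ?S'" unfolding a_def by (intro S mem)
  have kmem: "k u \<in> ?S'" if "u \<in> ?S" for u
    by (rule cyl_hom_mem[OF \<open>rhom k\<close> ring_closed_cyl that])
      (use kY ymem in \<open>auto simp: k_def subst2_simps Y_def intro!: cyl_gens amem Wmem\<close>)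
  have "f \<in> ring_iso (ring_on ?S') (ring_on ?S)"
  proof (rule ring_iso_memI)
    show "bij_betw f (carrier (ring_on ?S')) (carrier (ring_on ?S))"
      by (rule bij_betw_byWitness[where f' = k]) (auto simp: kf fk fmem kmem)
  qed (auto simp: fmem f.hom_simps)
  moreover have "f [:[:c:]:] = [:[:c:]:]" for c by (simp add: f_def subst2_simps)
  ultimately show ?thesis by (auto simp: alg_isomorphic_def)
qed

section \<open>Polynomial solutions of \<open>c \<xi>\<^sup>n = f(\<zeta>)\<close>\<close>

lemma pev_eq_pcompose:
  "pev (\<lambda>c. [:[:c:]:]) \<zeta> f = pcompose (map_poly (\<lambda>c. [:c:]) f) \<zeta>"
  by (simp add: pev_def pcompose_altdef map_poly_map_poly comp_def)

lemma degree_pev_cc0: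
  fixes \<zeta> :: "'k::field poly poly"
  shows "degree (pev (\<lambda>c. [:[:c:]:]) \<zeta> f) = degree f * degree \<zeta>"
  by (simp add: pev_eq_pcompose degree_pcompose degree_map_poly)

lemma derivation_pev_cc0:
  fixes \<zeta> :: "'k::field poly poly"
  assumes add: "\<And>a b. D (a + b) = D a + D b" and mult: "\<And>a b. D (a * b) = a * D b + b * D a"
    and const: "\<And>c. D [:[:c:]:] = 0"
  shows "D (pev (\<lambda>c. [:[:c:]:]) \<zeta> f) = pev (\<lambda>c. [:[:c:]:]) \<zeta> (pderiv f) * D \<zeta>"
proof (induction f)
  case 0
  show ?case using const[of 0] by simp
next
  case (pCons a f)
  show ?case
    by (simp add: cc0.pev_pCons add mult const pCons.IH pderiv_pCons rhom.hom_add[OF cc0.rhom_pev] algebra_simps)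
qed

lemma derivation_power:
  fixes \<xi> :: "'a::idom poly"
  assumes mult: "\<And>a b. D (a * b) = a * D b + b * D (a :: 'a poly)"
  shows "D (\<xi> ^ n) = of_nat n * \<xi> ^ (n - 1) * D \<xi>"
proof (induction n)
  case 0
  have "D (1 * 1) = 1 * D 1 + 1 * D 1" by (rule mult)
  then have "D 1 = D 1 + D 1" by (simp only: mult_1_left)
  then show ?case by (simp only: add_cancel_right_right power_0 of_nat_0 mult_zero_left)
next
  case (Suc n)
  then show ?case
    by (cases n) (simp_all add: mult algebra_simps)
qed

text \<open>In characteristic \<open>0\<close> the exponent is \<open>0\<close> and the conclusion says that \<open>r\<close> is constant.\<close>

lemma pderiv_eq_0_imp_frobenius:
  fixes r :: "'a::idom poly"
  assumes "pderiv r = 0"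
  shows "\<exists>s. r = pcompose s (Polynomial.monom 1 CHAR('a))"
proof (cases "CHAR('a) = 0")
  case True
  have "coeff r i = 0" if "i > 0" for i
    using arg_cong[OF assms, of "\<lambda>p. coeff p (i - 1)"] that True
    by (auto simp: coeff_pderiv of_nat_eq_0_iff_char_dvd simp flip: of_nat_Suc)
  then have "degree r = 0" by (metis leading_coeff_0_iff degree_0 not_gr_zero)
  then obtain c where "r = [:c:]" by (auto elim: degree_eq_zeroE)
  then show ?thesis by (intro exI[of _ "[:c:]"]) simp
next
  case False
  let ?p = "CHAR('a)"
  have zero: "coeff r i = 0" if "\<not> ?p dvd i" for i
  proof -
    have "i > 0" using that by (cases i) auto
    then show ?thesis
      using arg_cong[OF assms, of "\<lambda>p. coeff p (i - 1)"] that
      by (auto simp: coeff_pderiv of_nat_eq_0_iff_char_dvd simp flip: of_nat_Suc)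
  qed
  have monom: "pcompose (Polynomial.monom c j) u = smult c (u ^ j)" for c :: 'a and j u
    by (simp add: pcompose_altdef map_poly_monom poly_monom)
  define s where "s = (\<Sum>j\<le>degree r. Polynomial.monom (coeff r (?p * j)) j)"
  have "pcompose s (Polynomial.monom 1 ?p) = (\<Sum>j\<le>degree r. Polynomial.monom (coeff r (?p * j)) (?p * j))"
    by (simp add: s_def pcompose_sum monom monom_power smult_monom)
  also have "\<dots> = r"
  proof (rule poly_eqI)
    fix i
    have "coeff (\<Sum>j\<le>degree r. Polynomial.monom (coeff r (?p * j)) (?p * j)) i
      = (\<Sum>j\<le>degree r. if ?p * j = i then coeff r i else 0)"
      by (auto simp: coeff_sum intro!: sum.cong)
    also have "\<dots> = coeff r i"
    proof (cases "?p dvd i")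
      case True
      then obtain j0 where j0: "i = ?p * j0" by blast
      have "(\<Sum>j\<le>degree r. if ?p * j = i then coeff r i else 0) = (\<Sum>j\<le>degree r. if j = j0 then coeff r i else 0)"
        using False j0 by (intro sum.cong) auto
      also have "\<dots> = (if j0 \<le> degree r then coeff r i else 0)" by simp
      also have "\<dots> = coeff r i"
      proof -
        have "coeff r i = 0" if "\<not> j0 \<le> degree r"
        proof (rule coeff_eq_0)
          have "j0 \<le> i" using j0 False by simp
          with that show "degree r < i" by linarith
        qed
        then show ?thesis by simp
      qed
      finally show ?thesis .
    next
      case False
      then have "\<And>j. ?p * j \<noteq> i" by auto
      then show ?thesis using zero[OF False] by simp
    qed
    finally show "coeff (\<Sum>j\<le>degree r. Polynomial.monom (coeff r (?p * j)) (?p * j)) i = coeff r i" .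
  qed
  finally show ?thesis by metis
qed

lemma rhom_pcompose: "rhom (\<lambda>p. pcompose p (r :: 'a::comm_ring_1 poly))"
  by unfold_locales (simp_all add: pcompose_add pcompose_mult pcompose_1)

text \<open>Differentiate with respect to the variable \<open>S\<close> of \<open>\<xi>\<close> and \<open>\<zeta>\<close>. Since \<open>\<xi>\<close> divides \<open>f(\<zeta>)\<close>, it is coprime to \<open>f'(\<zeta>)\<close>, so
  \<open>\<xi>\<^sup>n\<^sup>-\<^sup>1\<close> divides \<open>\<zeta>'\<close>, which has smaller degree than \<open>\<zeta>\<close>. But \<open>\<xi>\<^sup>n\<^sup>-\<^sup>1\<close> has at least the degree of \<open>\<zeta>\<close>, because \<open>n\<close> and \<open>deg f\<close> are at least \<open>2\<close>; hence
  \<open>\<zeta>' = 0\<close>, and then \<open>\<xi>' = 0\<close>. So either both are constant, or both are polynomials in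
  \<open>S\<^sup>p\<close> with \<open>p\<close> the characteristic, and \<open>S\<^sup>p\<close> can be replaced by \<open>S\<close>.\<close>

lemma curve_tame:
  fixes f C :: "'k::field poly" and \<xi> \<zeta> :: "'k poly poly"
  assumes bez: "a * f + b * pderiv f = 1" and f: "2 \<le> degree f" and n: "2 \<le> n"
    and char: "of_nat n \<noteq> (0::'k)" and "C \<noteq> 0"
    and eq: "\<xi> ^ n * [:C:] = pev (\<lambda>c. [:[:c:]:]) \<zeta> f"
  shows "degree \<zeta> = 0"
  using eq
proof (induction "degree \<zeta>" arbitrary: \<xi> \<zeta> rule: less_induct)
  case less
  show ?case
  proof (rule ccontr)
    assume D: "degree \<zeta> \<noteq> 0"
    interpret z: rhom "pev (\<lambda>c. [:[:c:]:]) \<zeta>" by (rule cc0.rhom_pev)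
    let ?e = "pev (\<lambda>c. [:[:c:]:]) \<zeta>"
    have deg: "n * degree \<xi> = degree f * degree \<zeta>"
      using arg_cong[OF less.prems, of degree] \<open>C \<noteq> 0\<close> n
      by (cases "\<xi> = 0") (auto simp: degree_pev_cc0 degree_mult_eq degree_power_eq power_0_left)
    have \<xi>0: "\<xi> \<noteq> 0" using deg D f by auto
    have "pderiv (?e f) = ?e (pderiv f) * pderiv \<zeta>"
      by (rule derivation_pev_cc0) (simp_all add: pderiv_add pderiv_mult algebra_simps pderiv_pCons)
    moreover have "pderiv (\<xi> ^ n * [:C:]) = of_nat n * \<xi> ^ (n - 1) * pderiv \<xi> * [:C:]"
      by (subst pderiv_mult, subst derivation_power[where D = pderiv])
        (simp_all add: pderiv_mult algebra_simps pderiv_pCons)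
    ultimately have der: "of_nat n * \<xi> ^ (n - 1) * pderiv \<xi> * [:C:] = ?e (pderiv f) * pderiv \<zeta>"
      using less.prems by simp
    have "\<xi> ^ (n - 1) dvd ?e (pderiv f) * pderiv \<zeta>"
      unfolding der[symmetric] by (intro dvd_mult2 dvd_triv_right)
    moreover have "\<xi> ^ (n - 1) dvd ?e f"
      unfolding less.prems[symmetric] by (intro dvd_mult2 le_imp_power_dvd) simp
    ultimately have "\<xi> ^ (n - 1) dvd ?e a * ?e f * pderiv \<zeta> + ?e b * (?e (pderiv f) * pderiv \<zeta>)"
      by (intro dvd_add[OF dvd_mult2[OF dvd_mult] dvd_mult])
    also have "\<dots> = ?e (a * f + b * pderiv f) * pderiv \<zeta>"
      by (simp only: z.hom_simps algebra_simps)
    also have "\<dots> = pderiv \<zeta>" by (simp only: bez z.hom_one) simp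
    finally have dvd: "\<xi> ^ (n - 1) dvd pderiv \<zeta>" .
    have \<zeta>': "pderiv \<zeta> = 0"
    proof (rule ccontr)
      assume "pderiv \<zeta> \<noteq> 0"
      then have 1: "(n - 1) * degree \<xi> \<le> degree (pderiv \<zeta>)"
        using dvd_imp_degree_le[OF dvd] by (simp add: degree_power_eq \<xi>0)
      have 2: "degree (pderiv \<zeta>) < degree \<zeta>"
        using D by (intro degree_lessI) (auto simp: coeff_pderiv coeff_eq_0)
      have "2 * degree \<zeta> \<le> n * degree \<xi>" unfolding deg using f by simp
      also have "\<dots> \<le> (2 * (n - 1)) * degree \<xi>" using n by (intro mult_right_mono) auto
      finally show False using 1 2 by simp
    qed
    have "of_nat n * \<xi> ^ (n - 1) * pderiv \<xi> * [:C:] = 0" using der \<zeta>' by simp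
    moreover have "of_nat n \<noteq> (0 :: 'k poly poly)"
      using char by (simp add: of_nat_poly)
    ultimately have \<xi>': "pderiv \<xi> = 0" using \<xi>0 \<open>C \<noteq> 0\<close> by simp
    let ?T = "Polynomial.monom 1 CHAR('k poly) :: 'k poly poly"
    obtain \<zeta>1 \<xi>1 where s: "\<zeta> = pcompose \<zeta>1 ?T" "\<xi> = pcompose \<xi>1 ?T"
      using pderiv_eq_0_imp_frobenius \<zeta>' \<xi>' by metis
    have dT: "degree \<zeta> = degree \<zeta>1 * CHAR('k poly)"
      by (simp add: s(1) degree_pcompose Polynomial.degree_monom_eq)
    have "pcompose (\<xi>1 ^ n * [:C:] - pev (\<lambda>c. [:[:c:]:]) \<zeta>1 f) ?T = 0"
      using less.prems
      by (simp add: s pcompose_diff pcompose_mult pcompose_smult rhom.hom_power[OF rhom_pcompose] pev_eq_pcompose pcompose_assoc)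
    moreover have pos: "degree ?T > 0" using dT D by (simp add: Polynomial.degree_monom_eq)
    ultimately have "\<xi>1 ^ n * [:C:] = pev (\<lambda>c. [:[:c:]:]) \<zeta>1 f"
      by (simp add: pcompose_eq_0_iff)
    moreover have "degree \<zeta>1 < degree \<zeta>"
    proof -
      have "x < x * c" if "x * c \<noteq> 0" "c \<noteq> 1" for x c :: nat
        using that by (cases c) auto
      moreover have "CHAR('k poly) \<noteq> 1" by simp
      ultimately show ?thesis using dT D by metis
    qed
    ultimately have "degree \<zeta>1 = 0" using less.hyps by blast
    then show False using dT D by simp
  qed
qed

text \<open>When the characteristic divides \<open>n\<close>, the derivative with respect to \<open>S\<close> says nothing about \<open>\<xi>\<close>, and over
  an arbitrary coefficient \<open>C\<close> the equation may have solutions. With \<open>C = f(Z)\<close> one can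
  differentiate the coefficients with respect to \<open>Z\<close> instead: this derivation kills \<open>\<xi>\<^sup>n\<close>, and
  the same coprimality argument makes all of \<open>\<xi>\<^sup>n\<close>, whose degree is \<open>deg f\<close> times that of \<open>\<zeta>\<close>, divide
  the derivative of \<open>\<zeta>\<close>.\<close>

lemma curve_wild:
  fixes f :: "'k::field poly" and \<xi> \<zeta> :: "'k poly poly"
  assumes bez: "a * f + b * pderiv f = 1" and f: "2 \<le> degree f"
    and char: "of_nat n = (0::'k)"
    and eq: "\<xi> ^ n * [:f:] = pev (\<lambda>c. [:[:c:]:]) \<zeta> f"
  shows "degree \<zeta> = 0"
proof -
  interpret z: rhom "pev (\<lambda>c. [:[:c:]:]) \<zeta>" by (rule cc0.rhom_pev)
  let ?e = "pev (\<lambda>c. [:[:c:]:]) \<zeta>"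
  let ?D = "map_poly pderiv :: 'k poly poly \<Rightarrow> 'k poly poly"
  have cD: "coeff (?D p) i = pderiv (coeff p i)" for p i by (simp add: coeff_map_poly)
  have add: "?D (p + q) = ?D p + ?D q" for p q
    by (rule poly_eqI) (simp add: cD pderiv_add)
  have pds: "pderiv (sum u A) = (\<Sum>i\<in>A. pderiv (u i))" for u :: "nat \<Rightarrow> 'k poly" and A
    by (induction A rule: infinite_finite_induct) (simp_all add: pderiv_add)
  have mult: "?D (p * q) = p * ?D q + q * ?D p" for p q
  proof (rule poly_eqI)
    fix i
    have "coeff (?D (p * q)) i = coeff (p * ?D q + ?D p * q) i"
      by (simp only: coeff_mult cD coeff_add pds pderiv_mult sum.distrib) (simp add: mult.commute)
    then show "coeff (?D (p * q)) i = coeff (p * ?D q + q * ?D p) i"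
      by (simp only: mult.commute[of q])
  qed
  have "?D (?e f) = ?e (pderiv f) * ?D \<zeta>"
    by (rule derivation_pev_cc0[OF add mult]) (simp add: map_poly_pCons)
  moreover have "?D (\<xi> ^ n * [:f:]) = \<xi> ^ n * [:pderiv f:]"
    by (subst mult, subst derivation_power[where D = ?D])
      (simp_all add: mult char of_nat_poly map_poly_pCons)
  ultimately have der: "\<xi> ^ n * [:pderiv f:] = ?e (pderiv f) * ?D \<zeta>"
    using eq by simp
  have "\<xi> ^ n dvd ?e (pderiv f) * ?D \<zeta>"
    unfolding der[symmetric] by (rule dvd_triv_left)
  moreover have "\<xi> ^ n dvd ?e f"
    unfolding eq[symmetric] by (rule dvd_triv_left)
  ultimately have "\<xi> ^ n dvd ?e a * ?e f * ?D \<zeta> + ?e b * (?e (pderiv f) * ?D \<zeta>)"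
    by (intro dvd_add[OF dvd_mult2[OF dvd_mult] dvd_mult])
  also have "\<dots> = ?e (a * f + b * pderiv f) * ?D \<zeta>"
    by (simp only: z.hom_simps algebra_simps)
  also have "\<dots> = ?D \<zeta>" by (simp only: bez z.hom_one) simp
  finally have dvd: "\<xi> ^ n dvd ?D \<zeta>" .
  have deg: "degree (\<xi> ^ n) = degree f * degree \<zeta>"
  proof (cases "\<xi> ^ n = 0")
    case True
    then have "?e f = 0" by (simp only: eq[symmetric] mult_zero_left)
    then show ?thesis by (metis True degree_0 degree_pev_cc0)
  next
    case False
    moreover have "f \<noteq> 0" using f by auto
    ultimately have "degree (\<xi> ^ n * [:f:]) = degree (\<xi> ^ n)"
      by (subst degree_mult_eq) auto
    then show ?thesis by (simp only: eq degree_pev_cc0)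
  qed
  show ?thesis
  proof (cases "?D \<zeta> = 0")
    case True
    then have "\<xi> ^ n * [:pderiv f:] = 0" using der by simp
    moreover have "pderiv f \<noteq> 0"
    proof
      assume "pderiv f = 0"
      then have "f dvd 1" using bez by (metis add.right_neutral dvd_triv_right mult_zero_right)
      then show False using f dvd_imp_degree_le[of f 1] by simp
    qed
    ultimately have "degree f * degree \<zeta> = 0" using deg by (metis degree_0 mult_eq_0_iff pCons_eq_0_iff)
    then show ?thesis using f by simp
  next
    case False
    have "degree (?D \<zeta>) \<le> degree \<zeta>" by (rule degree_le) (simp add: cD coeff_eq_0)
    with dvd_imp_degree_le[OF dvd False] deg f have "2 * degree \<zeta> \<le> degree \<zeta>"
      by (metis le_trans mult_le_mono1)
    then show ?thesis by simp
  qed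
qed


section \<open>Filtrations and leading forms\<close>

text \<open>A decreasing filtration \<open>F\<close> with symbol maps \<open>G N\<close> that send an element of \<open>F N\<close> to its component of degree
  \<open>N\<close> in the associated graded ring. All components live in one ring \<open>'b\<close>, which amounts to setting the
  grading variable to \<open>1\<close>. Indices are real so that a variable may carry any rational weight.\<close>

locale filtration =
  fixes F :: "real \<Rightarrow> 'a::comm_ring_1 \<Rightarrow> bool" and G :: "real \<Rightarrow> 'a \<Rightarrow> 'b::comm_ring_1"
  assumes F_zero: "F N 0" and F_one: "F 0 1" and G_one: "G 0 1 = 1"
    and F_add: "F N a \<Longrightarrow> F N b \<Longrightarrow> F N (a + b)"
    and G_add: "F N a \<Longrightarrow> F N b \<Longrightarrow> G N (a + b) = G N a + G N b"
    and F_mult: "F N a \<Longrightarrow> F M b \<Longrightarrow> F (N + M) (a * b)"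
    and G_mult: "F N a \<Longrightarrow> F M b \<Longrightarrow> G (N + M) (a * b) = G N a * G M b"
    and F_mono: "F N a \<Longrightarrow> M \<le> N \<Longrightarrow> F M a"
    and G_lower: "F N a \<Longrightarrow> M < N \<Longrightarrow> G M a = 0"
begin

lemma G_zero: "G N 0 = 0"
  using G_add[OF F_zero F_zero, of N] by simp

lemma F_sum: "(\<And>x. x \<in> A \<Longrightarrow> F N (u x)) \<Longrightarrow> F N (sum u A)"
  by (induction A rule: infinite_finite_induct) (auto intro: F_zero F_add)

lemma G_sum: "(\<And>x. x \<in> A \<Longrightarrow> F N (u x)) \<Longrightarrow> G N (sum u A) = (\<Sum>x\<in>A. G N (u x))"
  by (induction A rule: infinite_finite_induct) (auto simp: G_zero G_add F_sum)

lemma F_power: "F N a \<Longrightarrow> F (real k * N) (a ^ k)"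
  by (induction k) (auto simp: F_one F_mult algebra_simps)

lemma G_power: "F N a \<Longrightarrow> G (real k * N) (a ^ k) = G N a ^ k"
proof (induction k)
  case (Suc k)
  have "G (N + real k * N) (a * a ^ k) = G N a * G (real k * N) (a ^ k)"
    by (rule G_mult[OF Suc.prems F_power[OF Suc.prems]])
  then show ?case using Suc by (simp add: algebra_simps)
qed (simp add: G_one)

end

text \<open>The extension to polynomials for which the variable has order \<open>w\<close>.\<close>

definition poly_F :: "(real \<Rightarrow> 'a::comm_ring_1 \<Rightarrow> bool) \<Rightarrow> real \<Rightarrow> real \<Rightarrow> 'a poly \<Rightarrow> bool"
  where "poly_F F w N p \<longleftrightarrow> (\<forall>i. F (N - real i * w) (coeff p i))"

definition poly_G :: "(real \<Rightarrow> 'a::comm_ring_1 \<Rightarrow> 'b::comm_ring_1) \<Rightarrow> real \<Rightarrow> real \<Rightarrow> 'a poly \<Rightarrow> 'b poly"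
  where "poly_G G w N p = (\<Sum>i\<le>degree p. Polynomial.monom (G (N - real i * w) (coeff p i)) i)"

lemma (in filtration) coeff_poly_G: "coeff (poly_G G w N p) i = G (N - real i * w) (coeff p i)"
  by (auto simp: poly_G_def coeff_sum coeff_eq_0 G_zero)

lemma (in filtration) filtration_poly: "filtration (poly_F F w) (poly_G G w)"
proof
  fix N M :: real and a b :: "'a poly"
  show "poly_F F w N 0" by (simp add: poly_F_def F_zero)
  show "poly_F F w 0 1" by (auto simp: poly_F_def F_zero F_one coeff_pCons one_pCons split: nat.splits)
  show "poly_G G w 0 1 = 1"
    by (rule poly_eqI) (auto simp: coeff_poly_G one_pCons coeff_pCons G_zero G_one split: nat.splits)
  show "poly_F F w N a \<Longrightarrow> M \<le> N \<Longrightarrow> poly_F F w M a"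
    unfolding poly_F_def by (meson F_mono diff_right_mono)
  show "poly_F F w N a \<Longrightarrow> M < N \<Longrightarrow> poly_G G w M a = 0"
    by (rule poly_eqI) (auto simp: coeff_poly_G poly_F_def intro: G_lower)
  assume a: "poly_F F w N a"
  { assume b: "poly_F F w N b"
    show "poly_F F w N (a + b)"
      using a b by (simp add: poly_F_def F_add)
    show "poly_G G w N (a + b) = poly_G G w N a + poly_G G w N b"
      using a b by (intro poly_eqI) (simp add: coeff_poly_G poly_F_def G_add) }
  assume b: "poly_F F w M b"
  have split: "N + M - real n * w = (N - real i * w) + (M - real (n - i) * w)" if "i \<le> n" for i n
    using that by (simp add: of_nat_diff algebra_simps)
  have F: "F (N + M - real n * w) (coeff a i * coeff b (n - i))" if "i \<le> n" for i n
    unfolding split[OF that] using a b by (auto simp: poly_F_def intro!: F_mult)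
  have G: "G (N + M - real n * w) (coeff a i * coeff b (n - i))
     = G (N - real i * w) (coeff a i) * G (M - real (n - i) * w) (coeff b (n - i))" if "i \<le> n" for i n
    unfolding split[OF that] using a b by (auto simp: poly_F_def intro!: G_mult)
  show "poly_F F w (N + M) (a * b)"
    by (auto simp: poly_F_def coeff_mult intro!: F_sum F)
  show "poly_G G w (N + M) (a * b) = poly_G G w N a * poly_G G w M b"
  proof (rule poly_eqI)
    fix n
    have "G (N + M - real n * w) (\<Sum>i\<le>n. coeff a i * coeff b (n - i))
      = (\<Sum>i\<le>n. G (N + M - real n * w) (coeff a i * coeff b (n - i)))"
      by (rule G_sum) (simp add: F)
    also have "\<dots> = (\<Sum>i\<le>n. G (N - real i * w) (coeff a i) * G (M - real (n - i) * w) (coeff b (n - i)))"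
      by (rule sum.cong[OF refl]) (use G in auto)
    finally show "coeff (poly_G G w (N + M) (a * b)) n = coeff (poly_G G w N a * poly_G G w M b) n"
      unfolding coeff_poly_G coeff_mult .
  qed
qed

definition fls_F :: "real \<Rightarrow> 'k::field fls \<Rightarrow> bool"
  where "fls_F N c \<longleftrightarrow> c = 0 \<or> N \<le> real_of_int (fls_subdegree c)"

definition fls_G :: "real \<Rightarrow> 'k::field fls \<Rightarrow> 'k"
  where "fls_G N c = (if N \<in> \<int> then fls_nth c \<lfloor>N\<rfloor> else 0)"

lemma fls_G_zero_below: "fls_F N c \<Longrightarrow> M < N \<Longrightarrow> fls_G M c = 0"
  by (cases "c = 0") (auto simp: fls_F_def fls_G_def Ints_def intro!: fls_eq0_below_subdegree)

lemma fls_F_iff: "fls_F N c \<longleftrightarrow> (\<forall>k. real_of_int k < N \<longrightarrow> fls_nth c k = 0)"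
proof (cases "c = 0")
  case False
  then have "fls_nth c (fls_subdegree c) \<noteq> 0" by (rule nth_fls_subdegree_nonzero)
  moreover have "fls_nth c k = 0" if "N \<le> real_of_int (fls_subdegree c)" "real_of_int k < N" for k
    using that by (intro fls_eq0_below_subdegree) linarith
  ultimately show ?thesis
    using False unfolding fls_F_def by (meson not_le)
qed (simp add: fls_F_def)

lemma filtration_fls: "filtration fls_F fls_G"
proof
  fix N M :: real and a b :: "'k::field fls"
  show "fls_F N 0" by (simp add: fls_F_def)
  show "fls_F 0 1" by (simp add: fls_F_def)
  show "fls_G 0 1 = 1" by (simp add: fls_G_def)
  show "fls_F N a \<Longrightarrow> M \<le> N \<Longrightarrow> fls_F M a" by (auto simp: fls_F_def)
  show "fls_F N a \<Longrightarrow> M < N \<Longrightarrow> fls_G M a = 0" by (rule fls_G_zero_below)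
  assume a: "fls_F N a"
  { assume b: "fls_F N b"
    show "fls_F N (a + b)" using a b by (simp add: fls_F_iff)
    show "fls_G N (a + b) = fls_G N a + fls_G N b" by (simp add: fls_G_def) }
  assume b: "fls_F M b"
  show mult: "fls_F (N + M) (a * b)"
    using a b by (cases "a = 0 \<or> b = 0") (auto simp: fls_F_def)
  show "fls_G (N + M) (a * b) = fls_G N a * fls_G M b"
  proof (cases "a = 0 \<or> b = 0")
    case False
    then have N: "N \<le> real_of_int (fls_subdegree a)" and M: "M \<le> real_of_int (fls_subdegree b)"
      using a b by (auto simp: fls_F_def)
    show ?thesis
    proof (cases "N = fls_subdegree a \<and> M = fls_subdegree b")
      case True
      then have NM: "N + M = real_of_int (fls_subdegree a + fls_subdegree b)" by simp
      show ?thesis unfolding NM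
        by (simp add: fls_G_def True flip: of_int_add)
    next
      case F: False
      then have "fls_G N a = 0 \<or> fls_G M b = 0"
        using fls_G_zero_below[of "fls_subdegree a" a N] fls_G_zero_below[of "fls_subdegree b" b M] N M
        by (fastforce simp: fls_F_def)
      moreover have "fls_G (N + M) (a * b) = 0"
        by (rule fls_G_zero_below[of "fls_subdegree a + fls_subdegree b"])
          (use F N M False in \<open>auto simp: fls_F_def\<close>)
      ultimately show ?thesis by auto
    qed
  qed (auto simp: fls_G_def)
qed

section \<open>Additive group actions fix \<open>X\<close>\<close>

lemma rhom_coeff_0: "rhom (\<lambda>r::'a::comm_ring_1 poly. coeff r 0)"
  by unfold_locales (simp_all add: coeff_mult)

interpretation c0: rhom "\<lambda>r::'a::comm_ring_1 poly. coeff r 0" by (rule rhom_coeff_0)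

text \<open>Restriction to the line \<open>X = 0\<close>.\<close>

definition at0 :: "'k::field poly poly \<Rightarrow> 'k poly"
  where "at0 = map_poly (\<lambda>r. coeff r 0)"

lemma rhom_at0: "rhom at0" unfolding at0_def by (rule c0.rhom_map_poly)

interpretation at0: rhom at0 by (rule rhom_at0)

lemma coeff_at0: "coeff (at0 p) i = coeff (coeff p i) 0"
  by (simp add: at0_def c0.coeff_hom)

lemma at0_pCons: "at0 (pCons r p) = pCons (coeff r 0) (at0 p)"
  by (simp add: at0_def c0.map_poly_pCons')

lemma at0_pderiv: "at0 (pderiv p) = pderiv (at0 p)"
  by (rule poly_eqI) (simp add: coeff_at0 coeff_pderiv coeff_mult of_nat_poly)

lemma split_power_of_X:
  fixes c :: "'k::field poly poly"
  assumes "c \<noteq> 0"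
  shows "\<exists>a c'. c = [:[:0, 1:] ^ a:] * c' \<and> at0 c' \<noteq> 0"
  using assms
proof (induction "degree (lead_coeff c)" arbitrary: c rule: less_induct)
  case less
  show ?case
  proof (cases "at0 c = 0")
    case False
    then show ?thesis by (intro exI[of _ 0] exI[of _ c]) (simp flip: one_pCons)
  next
    case True
    have "[:0, 1:] dvd coeff c i" for i
    proof -
      have "coeff (coeff c i) 0 = 0" using True coeff_at0[of c i] by simp
      then obtain r where "coeff c i = pCons 0 r" by (cases "coeff c i") auto
      then have "coeff c i = [:0, 1:] * r" by simp
      then show ?thesis by (simp only: dvd_triv_left)
    qed
    then have "[:[:0, 1:]:] dvd c" unfolding const_poly_dvd_iff by blast
    then obtain c1 where c1: "c = [:[:0, 1:]:] * c1" by blast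
    then have "c1 \<noteq> 0" "lead_coeff c = [:0, 1:] * lead_coeff c1"
      using less.prems by (auto simp: lead_coeff_mult)
    moreover have "degree (lead_coeff c1) < degree (lead_coeff c)"
      using calculation by (simp add: degree_mult_eq)
    ultimately obtain a c' where "c1 = [:[:0, 1:] ^ a:] * c'" "at0 c' \<noteq> 0"
      using less.hyps[of c1] by blast
    then show ?thesis
      by (intro exI[of _ "Suc a"] exI[of _ c']) (simp add: c1 mult_ac)
  qed
qed

text \<open>The filtration of \<open>F[Z]\<close> by the order of vanishing along \<open>X = 0\<close>, with \<open>Z\<close> of order \<open>0\<close>.\<close>

abbreviation "FZ \<equiv> poly_F fls_F 0"
abbreviation "GZ \<equiv> poly_G fls_G 0"

interpretation fls: filtration fls_F fls_G by (rule filtration_fls)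
interpretation fz: filtration FZ GZ by (rule fls.filtration_poly)
interpretation fs: filtration "poly_F FZ w" "poly_G GZ w" for w by (rule fz.filtration_poly)

lemma FZ_iff: "FZ N u \<longleftrightarrow> (\<forall>j. fls_F N (coeff u j))"
  by (simp add: poly_F_def)

lemma coeff_GZ: "coeff (GZ N u) j = fls_G N (coeff u j)"
  by (simp add: fls.coeff_poly_G)

lemma fls_base:
  "fls_F 0 (\<iota> [:c:])" "fls_G 0 (\<iota> [:c:]) = c" "fls_F 1 (\<iota> [:0, 1:])" "fls_G 1 (\<iota> [:0, 1:]) = 1"
  by (auto simp: fls_F_iff fls_G_def \<iota>_def fps_of_poly_const)

lemma fls_\<iota>: "fls_F 0 (\<iota> r)" "fls_G 0 (\<iota> r) = coeff r 0"
  by (auto simp: fls_F_iff fls_G_def \<iota>_def)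

lemma ycoord_leading:
  fixes \<phi> :: "'k::field poly poly"
  assumes g: "coeff g 0 \<noteq> 0"
  shows "FZ (- real n) (ycoord ([:0, 1:] ^ n * g) \<phi>)"
    and "GZ (- real n) (ycoord ([:0, 1:] ^ n * g) \<phi>) = smult (inverse (coeff g 0)) (at0 \<phi>)"
proof -
  let ?q = "[:0, 1:] ^ n * g"
  have q0: "\<iota> ?q \<noteq> 0" using g by (auto simp: \<iota>_eq_0_iff)
  have Fq: "fls_F (real n * 1 + 0) (\<iota> ?q)" unfolding \<iota>.hom_mult \<iota>.hom_power
    by (rule fls.F_mult[OF fls.F_power[OF fls_base(3)] fls_\<iota>(1)])
  have Gq: "fls_G (real n * 1 + 0) (\<iota> ?q) = coeff g 0" unfolding \<iota>.hom_mult \<iota>.hom_power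
      fls.G_mult[OF fls.F_power[OF fls_base(3)] fls_\<iota>(1)] fls.G_power[OF fls_base(3)]
    by (simp add: fls_base fls_\<iota>)
  have "fls_subdegree (\<iota> ?q) = int n"
  proof (rule fls_subdegree_eqI)
    show "fls_nth (\<iota> ?q) (int n) \<noteq> 0" using Gq g by (simp add: fls_G_def)
    show "\<And>k. k < int n \<Longrightarrow> fls_nth (\<iota> ?q) k = 0" using Fq by (simp add: fls_F_iff)
  qed
  then have Fi: "fls_F (- real n) (inverse (\<iota> ?q))"
    by (simp add: fls_F_def)
  have "fls_G (real n + - real n) (\<iota> ?q * inverse (\<iota> ?q)) = coeff g 0 * fls_G (- real n) (inverse (\<iota> ?q))"
    using fls.G_mult[OF Fq Fi] Gq by simp
  then have Gi: "fls_G (- real n) (inverse (\<iota> ?q)) = inverse (coeff g 0)"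
    using q0 g by (simp add: fls.G_one field_simps)
  have F: "fls_F (- real n + 0) (coeff (ycoord ?q \<phi>) j)" for j
    unfolding ycoord_def coeff_smult coeff_\<epsilon> by (intro fls.F_mult Fi fls_\<iota>)
  then show "FZ (- real n) (ycoord ?q \<phi>)" by (simp add: FZ_iff)
  have "fls_G (- real n + 0) (coeff (ycoord ?q \<phi>) j) = inverse (coeff g 0) * coeff (at0 \<phi>) j" for j
    unfolding ycoord_def coeff_smult coeff_\<epsilon> coeff_at0
    by (subst fls.G_mult[OF Fi fls_\<iota>(1)]) (simp add: Gi fls_\<iota>)
  then show "GZ (- real n) (ycoord ?q \<phi>) = smult (inverse (coeff g 0)) (at0 \<phi>)"
    by (intro poly_eqI) (simp add: coeff_GZ)
qed

text \<open>A pair \<open>(u, N)\<close> asks for the order of \<open>u\<close>, a polynomial in \<open>S\<close>, to be at least \<open>N\<close>. A coefficient \<open>X\<^sup>v\<close> of \<open>S\<^sup>i\<close>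
  allows this exactly when the order \<open>w\<close> of \<open>S\<close> is at least \<open>(N - v)/i\<close>. The largest of these finitely many
  bounds is attained by some coefficient, which then survives in the leading form.\<close>

lemma optimal_weight:
  fixes U :: "('k::field fls poly poly \<times> real) set"
  assumes fin: "finite U" and base: "\<And>u N. (u, N) \<in> U \<Longrightarrow> FZ N (coeff u 0)"
    and nonconst: "\<exists>(u, N)\<in>U. degree u > 0"
  shows "\<exists>w. (\<forall>(u, N)\<in>U. poly_F FZ w N u) \<and> (\<exists>(u, N)\<in>U. degree (poly_G GZ w N u) > 0)"
proof -
  define W where "W = (\<Union>(u, N)\<in>U. \<Union>i\<in>{1..degree u}. \<Union>j\<in>{j. j \<le> degree (coeff u i) \<and> coeff (coeff u i) j \<noteq> 0}.
    {(N - real_of_int (fls_subdegree (coeff (coeff u i) j))) / real i})"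
  have finW: "finite W" unfolding W_def using fin by auto
  have memW: "(N - real_of_int (fls_subdegree (coeff (coeff u i) j))) / real i \<in> W"
    if "(u, N) \<in> U" "0 < i" "coeff (coeff u i) j \<noteq> 0" for u N i j
  proof -
    have "i \<le> degree u" using that(3) by (intro le_degree) auto
    moreover have "j \<le> degree (coeff u i)" using that(3) by (rule le_degree)
    ultimately show ?thesis unfolding W_def using that by force
  qed
  obtain u0 N0 where u0: "(u0, N0) \<in> U" "degree u0 > 0" using nonconst by auto
  then have "coeff (coeff u0 (degree u0)) (degree (coeff u0 (degree u0))) \<noteq> 0" by auto
  from memW[OF u0(1) u0(2) this] have neW: "W \<noteq> {}" by auto
  define w where "w = Max W"
  have "poly_F FZ w N u" if "(u, N) \<in> U" for u N
    unfolding poly_F_def[of FZ]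
  proof
    fix i
    show "FZ (N - real i * w) (coeff u i)"
    proof (cases "i = 0")
      case True
      then show ?thesis using base[OF that] by simp
    next
      case False
      show ?thesis unfolding FZ_iff fls_F_def
      proof (intro allI disjCI)
        fix j assume "\<not> N - real i * w \<le> real_of_int (fls_subdegree (coeff (coeff u i) j))"
        moreover have "(N - real_of_int (fls_subdegree (coeff (coeff u i) j))) / real i \<le> w"
          if "coeff (coeff u i) j \<noteq> 0"
          unfolding w_def using memW[OF \<open>(u, N) \<in> U\<close> _ that] False finW by (intro Max_ge) auto
        ultimately show "coeff (coeff u i) j = 0"
          using False by (auto simp: field_simps)
      qed
    qed
  qed
  moreover have "w \<in> W" unfolding w_def by (rule Max_in[OF finW neW])
  then obtain u N i j where u: "(u, N) \<in> U" "1 \<le> i" "coeff (coeff u i) j \<noteq> 0"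
    "w = (N - real_of_int (fls_subdegree (coeff (coeff u i) j))) / real i"
    unfolding W_def by auto
  have "N - real i * w = real_of_int (fls_subdegree (coeff (coeff u i) j))"
    using u(2) by (simp add: u(4))
  then have "coeff (coeff (poly_G GZ w N u) i) j \<noteq> 0"
    using u(3) by (simp add: fz.coeff_poly_G coeff_GZ fls_G_def)
  then have "i \<le> degree (poly_G GZ w N u)" by (intro le_degree) auto
  then have "degree (poly_G GZ w N u) > 0" using u(2) by simp
  ultimately show ?thesis using u(1) by blast
qed


text \<open>\<open>H\<close> is an action of the additive group on the surface, composed with the presentation of its coordinate
  ring: \<open>H P\<close> is a polynomial in the time \<open>S\<close> whose value at \<open>S = 0\<close> is \<open>P\<close>. The proof is the leading form argument
  described at the beginning.\<close>

lemma coordinate_X_invariant: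
  fixes \<phi> :: "'k::field poly poly" and H :: "'k poly poly poly \<Rightarrow> 'k fls poly poly"
  assumes monic: "lead_coeff \<phi> = 1" and deg: "2 \<le> degree \<phi>"
    and bez: "\<alpha> * \<phi> + \<beta> * pderiv \<phi> = 1"
    and n: "2 \<le> n" and g: "coeff g 0 \<noteq> 0"
  defines "q \<equiv> [:0, 1:] ^ n * g"
  assumes H: "rhom H" and H_const: "\<And>c. H [:[:[:c:]:]:] = [:[:\<iota> [:c:]:]:]"
    and H_rel: "H (surf_rel q \<phi>) = 0" and H_0: "\<And>P. coeff (H P) 0 = ev q \<phi> P"
    and inv: "degree (H T) = 0" and T: "\<And>c. ev q \<phi> T \<noteq> [:\<iota> [:c:]:]"
  shows "degree (H [:[:[:0, 1:]:]:]) = 0"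
proof (rule ccontr)
  interpret H: rhom H by fact
  define d where "d = degree \<phi>"
  define f where "f = at0 \<phi>"
  let ?x = "H [:[:[:0, 1:]:]:]" and ?z = "H [:[:0, 1:]:]" and ?y = "H [:0, 1:]"
  assume nonfix: "degree ?x \<noteq> 0"
  have q0: "q \<noteq> 0" using g by (auto simp: q_def)
  have d: "0 < d" "2 \<le> d" using deg by (auto simp: d_def)
  have cf: "coeff f d = 1" unfolding f_def coeff_at0 d_def monic by simp
  have df: "degree f = d"
    using cf by (intro antisym le_degree degree_le) (auto simp: f_def coeff_at0 coeff_eq_0 d_def)
  have bezf: "at0 \<alpha> * f + at0 \<beta> * pderiv f = 1"
    using arg_cong[OF bez, of at0] by (simp add: at0.hom_simps at0_pderiv f_def)
  have ev_X: "ev q \<phi> [:[:[:0, 1:]:]:] = [:\<iota> [:0, 1:]:]" by (simp add: ev_const \<epsilon>_const)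
  have ev_Z: "ev q \<phi> [:[:0, 1:]:] = [:0, 1:]"
    by (simp add: ev_const \<epsilon>_pCons \<iota>.hom_zero \<iota>.hom_one \<epsilon>.hom_zero)

  let ?U = "{(?x, 1), (?z, 0), (?y, - real n)}"
  have base: "FZ N (coeff u 0)" if "(u, N) \<in> ?U" for u N
  proof -
    have "FZ 1 [:\<iota> [:0, 1:]:]" "FZ 0 [:0, 1:]"
      using fls_base fls.F_zero fls.F_one by (auto simp: FZ_iff coeff_pCons split: nat.splits)
    moreover have "FZ (- real n) (ycoord q \<phi>)"
      unfolding q_def by (rule ycoord_leading(1)[OF g])
    ultimately show ?thesis using that by (auto simp: H_0 ev_X ev_Z ev_Y)
  qed
  have "\<exists>w. (\<forall>(u, N)\<in>?U. poly_F FZ w N u) \<and> (\<exists>(u, N)\<in>?U. degree (poly_G GZ w N u) > 0)"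
    by (rule optimal_weight) (use base nonfix in auto)
  then obtain w where Fw: "poly_F FZ w 1 ?x" "poly_F FZ w 0 ?z" "poly_F FZ w (- real n) ?y"
    and nonconst: "\<exists>(u, N)\<in>?U. degree (poly_G GZ w N u) > 0"
    by auto
  define \<xi> \<zeta> \<eta> where "\<xi> = poly_G GZ w 1 ?x" and "\<zeta> = poly_G GZ w 0 ?z" and "\<eta> = poly_G GZ w (- real n) ?y"
  let ?F = "poly_F FZ w" and ?G = "poly_G GZ w"
  let ?cc = "\<lambda>c::'k. [:[:c:]:]"
  let ?e = "pev ?cc \<zeta>"
  interpret e: rhom ?e by (rule cc0.rhom_pev)
  have nc: "degree \<xi> > 0 \<or> degree \<zeta> > 0 \<or> degree \<eta> > 0"
    using nonconst by (auto simp: \<xi>_def \<zeta>_def \<eta>_def)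
  have \<xi>0: "coeff \<xi> 0 = 1"
    by (rule poly_eqI)
      (simp add: \<xi>_def fz.coeff_poly_G H_0 ev_X coeff_GZ coeff_pCons fls_base fls.G_zero one_pCons split: nat.splits)
  have \<eta>0: "coeff \<eta> 0 = smult (inverse (coeff g 0)) f"
    using ycoord_leading(2)[OF g, of n \<phi>]
    by (simp add: \<eta>_def fz.coeff_poly_G H_0 ev_Y f_def q_def)
  have "f \<noteq> 0" using cf by auto
  then have nz: "\<xi> \<noteq> 0" "\<eta> \<noteq> 0" using \<xi>0 \<eta>0 g by auto

  have F_const: "?F 0 [:[:\<iota> [:c:]:]:]" "?G 0 [:[:\<iota> [:c:]:]:] = ?cc c" for c
  proof -
    have *: "FZ 0 [:\<iota> [:c:]:]" "GZ 0 [:\<iota> [:c:]:] = [:c:]"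
      by (auto simp: FZ_iff coeff_GZ coeff_pCons fls_base fls.F_zero fls.G_zero intro!: poly_eqI split: nat.splits)
    show "?F 0 [:[:\<iota> [:c:]:]:]"
      unfolding poly_F_def[of FZ] using * fz.F_zero by (auto simp: coeff_pCons split: nat.splits)
    show "?G 0 [:[:\<iota> [:c:]:]:] = ?cc c"
      using * by (intro poly_eqI) (auto simp: fz.coeff_poly_G coeff_pCons fz.G_zero split: nat.splits)
  qed
  have F_r: "?F 0 (H [:[:r:]:]) \<and> ?G 0 (H [:[:r:]:]) = ?cc (coeff r 0)" for r
  proof (induction r)
    case 0
    then show ?case using F_const[of 0] by (simp add: H.hom_zero fs.F_zero fs.G_zero)
  next
    case (pCons a r)
    have "[:[:pCons a r:]:] = [:[:[:a:]:]:] + [:[:[:0, 1:]:]:] * [:[:r:]:]" by simp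
    then have E: "H [:[:pCons a r:]:] = [:[:\<iota> [:a:]:]:] + ?x * H [:[:r:]:]"
      by (simp only: H.hom_simps H_const)
    have 1: "?F (1 + 0) (?x * H [:[:r:]:])" using fs.F_mult[OF Fw(1)] pCons.IH by blast
    have 0: "?F 0 (?x * H [:[:r:]:])" using 1 by (rule fs.F_mono) simp
    have "?G 0 (?x * H [:[:r:]:]) = 0" using 1 by (rule fs.G_lower) simp
    then show ?case unfolding E
      using fs.F_add[OF F_const(1) 0, of a] fs.G_add[OF F_const(1) 0, of a] F_const(2)[of a] by simp
  qed
  have F_c: "?F 0 (H [:c:]) \<and> ?G 0 (H [:c:]) = ?e (at0 c)" for c
  proof (induction c)
    case 0
    then show ?case by (simp add: H.hom_zero fs.F_zero fs.G_zero at0.hom_zero)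
  next
    case (pCons r c)
    have "[:pCons r c:] = [:[:r:]:] + [:[:0, 1:]:] * [:c:]" by simp
    then have E: "H [:pCons r c:] = H [:[:r:]:] + ?z * H [:c:]"
      by (simp only: H.hom_simps)
    have F: "?F (0 + 0) (?z * H [:c:])" and G: "?G (0 + 0) (?z * H [:c:]) = \<zeta> * ?e (at0 c)"
      unfolding \<zeta>_def using fs.F_mult[OF Fw(2)] fs.G_mult[OF Fw(2)] pCons.IH by (blast, metis \<zeta>_def)
    show ?case unfolding E
      using fs.F_add[of w 0 "H [:[:r:]:]" "?z * H [:c:]"] fs.G_add[of w 0 "H [:[:r:]:]" "?z * H [:c:]"] F_r[of r] F G
      by (simp add: at0_pCons cc0.pev_pCons)
  qed
  have mono: "?F (real a - real n * real k) (H [:[:[:0, 1:] ^ a:] * c':] * ?y ^ k)"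
    "?G (real a - real n * real k) (H [:[:[:0, 1:] ^ a:] * c':] * ?y ^ k) = \<xi> ^ a * ?e (at0 c') * \<eta> ^ k" for a c' k
  proof -
    have "[:[:[:0, 1:] ^ a:] * c':] = [:[:[:0, 1:]:]:] ^ a * [:c':]"
      by (simp add: poly_const_pow)
    then have E: "H [:[:[:0, 1:] ^ a:] * c':] * ?y ^ k = ?x ^ a * H [:c':] * ?y ^ k"
      by (simp only: H.hom_simps)
    have N: "real a - real n * real k = real a * 1 + 0 + real k * (- real n)" by simp
    have Fc: "?F 0 (H [:c':])" using F_c by blast
    show "?F (real a - real n * real k) (H [:[:[:0, 1:] ^ a:] * c':] * ?y ^ k)"
      unfolding E N by (intro fs.F_mult fs.F_power Fw Fc)
    show "?G (real a - real n * real k) (H [:[:[:0, 1:] ^ a:] * c':] * ?y ^ k) = \<xi> ^ a * ?e (at0 c') * \<eta> ^ k"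
      unfolding E N fs.G_mult[OF fs.F_mult[OF fs.F_power[OF Fw(1)] Fc] fs.F_power[OF Fw(3)]]
        fs.G_mult[OF fs.F_power[OF Fw(1)] Fc] fs.G_power[OF Fw(1)] fs.G_power[OF Fw(3)]
      using F_c[of c'] by (simp add: \<xi>_def \<eta>_def)
  qed

  define f1 where "f1 = smult (inverse (coeff g 0)) f"
  have curve: "\<xi> ^ n * \<eta> = ?e f1"
  proof -
    have "H [:[:q:]:] * ?y = H [:\<phi>:]"
      using H_rel by (simp only: surf_rel_def H.hom_simps) simp
    moreover have "[:[:q:]:] = [:[:[:0, 1:] ^ n:] * [:g:]:]"
      by (simp add: q_def)
    ultimately have "?G 0 (H [:[:[:0, 1:] ^ n:] * [:g:]:] * ?y ^ 1) = ?G 0 (H [:\<phi>:])" by simp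
    then have "\<xi> ^ n * ?e (at0 [:g:]) * \<eta> = ?e f"
      using mono(2)[of n 1 "[:g:]"] F_c[of \<phi>] by (simp add: f_def)
    moreover have "?e (at0 [:g:]) = ?cc (coeff g 0)"
      by (simp add: at0_pCons at0.hom_zero cc0.pev_const)
    moreover have "?e f1 = ?cc (inverse (coeff g 0)) * ?e f"
      using e.hom_mult[of "[:inverse (coeff g 0):]" f] by (simp add: f1_def cc0.pev_const)
    ultimately have "?e f1 = ?cc (inverse (coeff g 0)) * (\<xi> ^ n * ?cc (coeff g 0) * \<eta>)"
      by (simp only:)
    also have "\<dots> = ?cc (inverse (coeff g 0)) * ?cc (coeff g 0) * (\<xi> ^ n * \<eta>)"
      by (simp only: mult_ac)
    also have "?cc (inverse (coeff g 0)) * ?cc (coeff g 0) = 1"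
      using g by (simp add: one_pCons)
    finally show ?thesis by simp
  qed
  have df1: "degree f1 = d" using g df by (simp add: f1_def)
  have \<zeta>pos: "degree \<zeta> > 0"
  proof (rule ccontr)
    assume "\<not> degree \<zeta> > 0"
    then have "degree (\<xi> ^ n * \<eta>) = 0" by (simp add: curve degree_pev_cc0)
    then have "n * degree \<xi> + degree \<eta> = 0" using nz by (simp add: degree_mult_eq degree_power_eq)
    then show False using nc n \<open>\<not> degree \<zeta> > 0\<close> by auto
  qed
  have \<eta>pos: "degree \<eta> > 0"
  proof (rule ccontr)
    assume "\<not> degree \<eta> > 0"
    then have "\<eta> = [:f1:]" using \<eta>0 degree_0_const[of \<eta>] by (simp add: f1_def)
    then have eq: "\<xi> ^ n * [:f1:] = ?e f1" using curve by simp
    define a b where "a = smult (coeff g 0) (at0 \<alpha>)" and "b = smult (coeff g 0) (at0 \<beta>)"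
    have bez1: "a * f1 + b * pderiv f1 = 1"
      using bezf g by (simp add: a_def b_def f1_def pderiv_smult)
    have "f1 \<noteq> 0" using df1 d by auto
    then have "degree \<zeta> = 0"
      using curve_wild[OF bez1 _ _ eq] curve_tame[OF bez1 _ n _ _ eq] df1 d by auto
    then show False using \<zeta>pos by simp
  qed

  have H_eq: "H P = H P'" if "ev q \<phi> P = ev q \<phi> P'" for P P'
  proof -
    have "ev q \<phi> (P - P') = 0" using that by (simp add: ev.hom_diff)
    then have "surf_rel q \<phi> dvd P - P'"
      using ev_eq_0_iff[OF monic d(1)[unfolded d_def] q0] by simp
    then have "H (P - P') = 0" by (auto elim!: dvdE simp: H.hom_mult H_rel)
    then show ?thesis by (simp add: H.hom_diff)
  qed
  \<comment> \<open>Normalise the fixed element: normal form, and no constant term.\<close>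
  obtain T0 where T0: "ev q \<phi> T = ev q \<phi> T0" "\<And>i. degree (coeff T0 i) < d"
    using surf_normal_form[OF monic d(1)[unfolded d_def] q0, of "ev q \<phi> T"]
    unfolding surf_def d_def by blast
  define P where "P = T0 - [:[:[:coeff (coeff (coeff T0 0) 0) 0:]:]:]"
  have P_d: "degree (coeff P i) < d" for i
    unfolding P_def using T0(2)[of i] d by (cases i) (auto intro: degree_diff_less)
  have P_0: "coeff (coeff (coeff P 0) 0) 0 = 0" by (simp add: P_def)
  have "P \<noteq> 0"
  proof
    assume "P = 0"
    then have "ev q \<phi> T = ev q \<phi> [:[:[:coeff (coeff (coeff T0 0) 0) 0:]:]:]"
      using T0(1) by (simp add: P_def)
    then show False using T by (simp add: ev_const \<epsilon>_const)
  qed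
  have "ev q \<phi> P \<noteq> 0"
    by (rule normal_form_degree(3)[OF monic d(1)[unfolded d_def] q0 P_d[unfolded d_def] \<open>P \<noteq> 0\<close>])
  then have HP0: "H P \<noteq> 0" using H_0[of P] by auto
  have HP: "degree (H P) = 0"
  proof -
    have "H P = H T - [:[:\<iota> [:coeff (coeff (coeff T0 0) 0) 0:]:]:]"
      by (simp add: P_def H.hom_diff H_const H_eq[OF T0(1)])
    then have "degree (H P) \<le> 0"
      using degree_diff_le[of "H T" 0 "[:[:\<iota> [:coeff (coeff (coeff T0 0) 0) 0:]:]:]"] inv by simp
    then show ?thesis by simp
  qed

  \<comment> \<open>The term \<open>c\<^sub>k Y\<^sup>k\<close> of \<open>P\<close> has order \<open>v k\<close>; the terms indexed by \<open>I\<close> make up the leading form.\<close>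
  define K where "K = {k. coeff P k \<noteq> 0}"
  have K: "finite K" "K \<noteq> {}" "K \<subseteq> {..degree P}"
  proof -
    show "K \<subseteq> {..degree P}" by (auto simp: K_def intro: le_degree)
    then show "finite K" by (rule finite_subset) simp
    show "K \<noteq> {}" using \<open>P \<noteq> 0\<close> by (auto simp: K_def poly_eq_iff)
  qed
  have "\<forall>k\<in>K. \<exists>a c. coeff P k = [:[:0, 1:] ^ a:] * c \<and> at0 c \<noteq> 0"
    using split_power_of_X by (auto simp: K_def)
  then obtain a where "\<forall>k\<in>K. \<exists>c. coeff P k = [:[:0, 1:] ^ a k:] * c \<and> at0 c \<noteq> 0"
    by metis
  then obtain c where c: "\<And>k. k \<in> K \<Longrightarrow> coeff P k = [:[:0, 1:] ^ a k:] * c k"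
    "\<And>k. k \<in> K \<Longrightarrow> at0 (c k) \<noteq> 0" by metis
  define v where "v k = int (a k) - int n * int k" for k
  define N where "N = Min (v ` K)"
  have N_le: "N \<le> v k" if "k \<in> K" for k unfolding N_def using K that by simp
  define I where "I = {k \<in> K. v k = N}"
  have "N \<in> v ` K" unfolding N_def using K by (intro Min_in) auto
  then have I: "finite I" "I \<noteq> {}" "I \<subseteq> K" using K by (auto simp: I_def)
  have HP_sum: "H P = (\<Sum>k\<in>K. H [:coeff P k:] * ?y ^ k)"
  proof -
    interpret h: rhom "\<lambda>a. H [:a:]" by (rule rhom_comp[OF rhom_const H])
    have "H P = pev (\<lambda>a. H [:a:]) ?y P" by (rule rhom_eq_pev[OF H])
    also have "\<dots> = (\<Sum>k\<le>degree P. H [:coeff P k:] * ?y ^ k)"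
      by (rule h.pev_altdef)
    also have "\<dots> = (\<Sum>k\<in>K. H [:coeff P k:] * ?y ^ k)"
      using K by (intro sum.mono_neutral_right) (auto simp: K_def H.hom_zero)
    finally show ?thesis .
  qed
  have vr: "real_of_int (v k) = real (a k) - real n * real k" for k by (simp add: v_def)
  have HF: "?F (real_of_int (v k)) (H [:coeff P k:] * ?y ^ k)"
    and HG: "?G (real_of_int (v k)) (H [:coeff P k:] * ?y ^ k) = \<xi> ^ a k * ?e (at0 (c k)) * \<eta> ^ k"
    if "k \<in> K" for k
    unfolding vr c(1)[OF that] by (rule mono)+
  have "?G (real_of_int N) (H P) = (\<Sum>k\<in>K. ?G (real_of_int N) (H [:coeff P k:] * ?y ^ k))"
    unfolding HP_sum
  proof (rule fs.G_sum)
    show "?F (real_of_int N) (H [:coeff P k:] * ?y ^ k)" if "k \<in> K" for k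
      by (rule fs.F_mono[OF HF[OF that]]) (simp add: N_le[OF that])
  qed
  also have "\<dots> = (\<Sum>k\<in>I. \<xi> ^ a k * ?e (at0 (c k)) * \<eta> ^ k)"
  proof (rule sum.mono_neutral_cong_right[OF K(1) I(3)])
    show "\<forall>k\<in>K - I. ?G (real_of_int N) (H [:coeff P k:] * ?y ^ k) = 0"
      using N_le by (force simp: I_def intro: fs.G_lower[OF HF])
    show "?G (real_of_int N) (H [:coeff P k:] * ?y ^ k) = \<xi> ^ a k * ?e (at0 (c k)) * \<eta> ^ k" if "k \<in> I" for k
      using HG[of k] that by (auto simp: I_def)
  qed
  finally have lead: "?G (real_of_int N) (H P) = (\<Sum>k\<in>I. \<xi> ^ a k * ?e (at0 (c k)) * \<eta> ^ k)" .
  have lead_deg: "degree (?G (real_of_int N) (H P)) = 0"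
  proof -
    have "degree (?G (real_of_int N) (H P)) \<le> 0"
      using HP by (intro degree_le) (auto simp: fz.coeff_poly_G coeff_eq_0 fz.G_zero)
    then show ?thesis by simp
  qed

  \<comment> \<open>All leading terms have the same order, so their exponents of \<open>X\<close> and \<open>Y\<close> differ from those of \<open>X\<^sup>b Y\<^sup>k\<^sup>0\<close> by multiples
    of \<open>(n, 1)\<close>. As \<open>\<xi>\<^sup>n \<eta> = f1(\<zeta>)\<close>, the leading form becomes \<open>\<xi>\<^sup>b \<eta>\<^sup>k\<^sup>0\<close> times a polynomial in \<open>\<zeta>\<close>.\<close>
  define k0 where "k0 = (LEAST k. 0 \<le> N + int n * int k)"
  have ex: "\<exists>k. 0 \<le> N + int n * int k"
  proof -
    from I obtain k where "k \<in> I" by blast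
    then have "N + int n * int k = int (a k)" by (simp add: I_def v_def)
    then show ?thesis by (metis of_nat_0_le_iff)
  qed
  have k0: "0 \<le> N + int n * int k0" unfolding k0_def using ex by (rule LeastI_ex)
  define b where "b = nat (N + int n * int k0)"
  have ab: "k0 \<le> k" "a k = b + n * (k - k0)" if "k \<in> I" for k
  proof -
    have ak: "int (a k) = N + int n * int k" using that by (simp add: I_def v_def)
    then show le: "k0 \<le> k" unfolding k0_def by (intro Least_le) simp
    obtain j where j: "k = k0 + j" using le_Suc_ex[OF le] by blast
    have "int b = N + int n * int k0" using k0 by (simp add: b_def)
    then have "int (a k) = int (b + n * (k - k0))"
      unfolding ak by (simp add: j algebra_simps)
    then show "a k = b + n * (k - k0)" by (simp only: of_nat_eq_iff)
  qed
  define \<Gamma> where "\<Gamma> = (\<Sum>k\<in>I. Polynomial.monom (at0 (c k)) (k - k0))"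
  have "?e (poly \<Gamma> f1) = (\<Sum>k\<in>I. ?e (at0 (c k)) * (\<xi> ^ n * \<eta>) ^ (k - k0))"
    by (simp add: \<Gamma>_def poly_sum poly_monom e.hom_sum e.hom_mult e.hom_power curve)
  then have "\<xi> ^ b * \<eta> ^ k0 * ?e (poly \<Gamma> f1) = (\<Sum>k\<in>I. \<xi> ^ b * \<eta> ^ k0 * (?e (at0 (c k)) * (\<xi> ^ n * \<eta>) ^ (k - k0)))"
    by (simp only: sum_distrib_left)
  also have "\<dots> = (\<Sum>k\<in>I. \<xi> ^ a k * ?e (at0 (c k)) * \<eta> ^ k)"
  proof (rule sum.cong[OF refl])
    fix k assume "k \<in> I"
    from ab[OF this] obtain j where k: "k = k0 + j" "a k = b + n * j"
      by (metis add_diff_cancel_left' le_Suc_ex)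
    show "\<xi> ^ b * \<eta> ^ k0 * (?e (at0 (c k)) * (\<xi> ^ n * \<eta>) ^ (k - k0)) = \<xi> ^ a k * ?e (at0 (c k)) * \<eta> ^ k"
      unfolding k(2) by (simp add: k(1) power_add power_mult_distrib mult_ac flip: power_mult)
  qed
  finally have prod: "\<xi> ^ b * \<eta> ^ k0 * ?e (poly \<Gamma> f1) = ?G (real_of_int N) (H P)"
    by (simp only: lead)

  have \<Gamma>_coeff: "coeff \<Gamma> j = (if j + k0 \<in> I then at0 (c (j + k0)) else 0)" for j
  proof -
    have "coeff \<Gamma> j = (\<Sum>k\<in>I. if k = j + k0 then at0 (c k) else 0)"
      unfolding \<Gamma>_def coeff_sum
      by (rule sum.cong[OF refl]) (use ab(1) in \<open>force\<close>)
    then show ?thesis using I(1) by simp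
  qed
  have "degree (at0 (c k)) < d" if "k \<in> K" for k
  proof -
    have "degree (c k) = degree (coeff P k)"
      by (simp add: c(1)[OF that])
    moreover have "degree (at0 (c k)) \<le> degree (c k)"
      by (rule degree_le) (simp add: coeff_at0 coeff_eq_0)
    ultimately show ?thesis using P_d[of k] by simp
  qed
  then have \<Gamma>_small: "degree (coeff \<Gamma> j) < d" for j
    using I(3) d by (auto simp: \<Gamma>_coeff)
  have "\<Gamma> \<noteq> 0"
  proof -
    from I obtain k where k: "k \<in> I" by blast
    then have "coeff \<Gamma> (k - k0) \<noteq> 0" using ab(1)[OF k] c(2) I by (auto simp: \<Gamma>_coeff)
    then show ?thesis by auto
  qed
  note \<Gamma>_degree = degree_poly_small_coeffs[OF df1 d(1) \<Gamma>_small this]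
  have e_inj: "?e p \<noteq> 0" if "p \<noteq> 0" for p
  proof (cases "degree p = 0")
    case True
    then obtain s where "p = [:s:]" by (auto elim: degree_eq_zeroE)
    then show ?thesis using that by (simp add: cc0.pev_const)
  next
    case False
    then have "degree (?e p) > 0" using \<zeta>pos by (simp add: degree_pev_cc0)
    then show ?thesis by auto
  qed
  have "degree (\<xi> ^ b * \<eta> ^ k0 * ?e (poly \<Gamma> f1)) = b * degree \<xi> + k0 * degree \<eta> + degree (poly \<Gamma> f1) * degree \<zeta>"
    using nz e_inj \<Gamma>_degree by (simp add: degree_mult_eq degree_power_eq degree_pev_cc0)
  then have "k0 = 0" "degree (poly \<Gamma> f1) = 0"
    using lead_deg \<eta>pos \<zeta>pos by (auto simp: prod)
  have "N \<ge> 0" using k0 \<open>k0 = 0\<close> by simp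
  have dG: "degree \<Gamma> = 0" "degree (coeff \<Gamma> 0) = 0"
    using \<Gamma>_degree \<open>degree (poly \<Gamma> f1) = 0\<close> d by auto
  \<comment> \<open>The leading form does not involve \<open>Z\<close>; at order \<open>0\<close> it would be the constant term, which was removed.\<close>
  have "N \<noteq> 0"
  proof
    assume "N = 0"
    have "coeff \<Gamma> 0 \<noteq> 0" using dG \<open>\<Gamma> \<noteq> 0\<close> by (metis leading_coeff_0_iff)
    then have "0 \<in> I" "coeff (at0 (c 0)) 0 \<noteq> 0"
      using dG(2) by (auto simp: \<Gamma>_coeff \<open>k0 = 0\<close> split: if_splits) (metis leading_coeff_0_iff)
    then have "a 0 = 0" using \<open>N = 0\<close> by (simp add: I_def v_def)
    then have "coeff P 0 = c 0" using c(1)[of 0] \<open>0 \<in> I\<close> by (auto simp: I_def simp flip: one_pCons)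
    then show False using P_0 \<open>coeff (at0 (c 0)) 0 \<noteq> 0\<close> by (simp add: coeff_at0)
  qed
  then have "N > 0" using \<open>N \<ge> 0\<close> by simp
  have "[:[:0, 1:]:] dvd coeff P k" for k
  proof (cases "k \<in> K")
    case True
    have "0 \<le> int n * int k" by simp
    then have "int (a k) > 0"
      using N_le[OF True] \<open>N > 0\<close> unfolding v_def by linarith
    then have "a k > 0" by simp
    then obtain j where "a k = Suc j" by (cases "a k") auto
    then have "coeff P k = [:[:0, 1:]:] * ([:[:0, 1:] ^ j:] * c k)"
      using c(1)[OF True] by (simp add: mult_ac)
    then show ?thesis by (simp only: dvd_triv_left)
  qed (simp add: K_def)
  then have "[:[:[:0, 1:]:]:] dvd P" unfolding const_poly_dvd_iff by blast
  then obtain U where "P = [:[:[:0, 1:]:]:] * U" by (elim dvdE)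
  then have "H P = ?x * H U" by (simp only: H.hom_mult)
  then have "degree ?x + degree (H U) = 0"
    using HP HP0 by (simp add: degree_mult_eq)
  then show False using nonfix by simp
qed

section \<open>Isomorphisms of the surfaces\<close>

text \<open>Mutually inverse \<open>K\<close>-algebra isomorphisms between two subrings. Both maps are kept, since
  the arguments below alternate between an isomorphism and its inverse.\<close>

definition iso_pair :: "'k::field fls poly set \<Rightarrow> 'k fls poly set \<Rightarrow>
    ('k fls poly \<Rightarrow> 'k fls poly) \<Rightarrow> ('k fls poly \<Rightarrow> 'k fls poly) \<Rightarrow> bool"
  where "iso_pair C D h k \<longleftrightarrow>
    (\<forall>u\<in>C. h u \<in> D \<and> k (h u) = u) \<and> (\<forall>u\<in>D. k u \<in> C \<and> h (k u) = u) \<and>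
    (\<forall>u\<in>C. \<forall>v\<in>C. h (u + v) = h u + h v \<and> h (u * v) = h u * h v) \<and>
    (\<forall>c. h [:\<iota> [:c:]:] = [:\<iota> [:c:]:])"

lemma iso_pairD:
  assumes "iso_pair C D h k"
  shows "u \<in> C \<Longrightarrow> h u \<in> D" "u \<in> C \<Longrightarrow> k (h u) = u" "w \<in> D \<Longrightarrow> k w \<in> C" "w \<in> D \<Longrightarrow> h (k w) = w"
    "u \<in> C \<Longrightarrow> v \<in> C \<Longrightarrow> h (u + v) = h u + h v" "u \<in> C \<Longrightarrow> v \<in> C \<Longrightarrow> h (u * v) = h u * h v"
    "h [:\<iota> [:c:]:] = [:\<iota> [:c:]:]"
  using assms unfolding iso_pair_def by blast+

lemma surf_mem:
  "\<epsilon> c \<in> surf q \<phi>" "[:\<iota> r:] \<in> surf q \<phi>" "[:0, 1:] \<in> surf q \<phi>" "ycoord q \<phi> \<in> surf q \<phi>"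
proof -
  show *: "\<epsilon> c \<in> surf q \<phi>" for c unfolding surf_def using ev_const by (metis rangeI)
  show "[:\<iota> r:] \<in> surf q \<phi>" using *[of "[:r:]"] by (simp add: \<epsilon>_const)
  show "[:0, 1:] \<in> surf q \<phi>" using *[of "[:0, 1:]"]
    by (simp add: \<epsilon>_pCons \<iota>.hom_zero \<iota>.hom_one \<epsilon>.hom_zero)
  show "ycoord q \<phi> \<in> surf q \<phi>" unfolding surf_def using ev_Y by (metis rangeI)
qed

lemma ring_closed_surf: "ring_closed (surf q \<phi>)"
  unfolding surf_def by (rule ev.ring_closed_range)

lemma iso_pair_sym:
  assumes "iso_pair (surf q \<phi>) (surf q' \<phi>) h k"
  shows "iso_pair (surf q' \<phi>) (surf q \<phi>) k h"
proof -
  note I = iso_pairD[OF assms]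
  note C = ring_closedD[OF ring_closed_surf[of q \<phi>]]
  have "k (u + v) = k u + k v" "k (u * v) = k u * k v" if "u \<in> surf q' \<phi>" "v \<in> surf q' \<phi>" for u v
    using I(2)[OF C(6)[OF I(3)[OF that(1)] I(3)[OF that(2)]]] I(2)[OF C(4)[OF I(3)[OF that(1)] I(3)[OF that(2)]]]
      I(5,6)[OF I(3)[OF that(1)] I(3)[OF that(2)]] I(4)[OF that(1)] I(4)[OF that(2)] by simp_all
  moreover have "k [:\<iota> [:c:]:] = [:\<iota> [:c:]:]" for c
    using I(2)[OF surf_mem(2), of "[:c:]"] I(7) by simp
  ultimately show ?thesis unfolding iso_pair_def using I by blast
qed

lemma alg_isomorphic_iso_pair:
  assumes "alg_isomorphic (ring_on C) (\<lambda>c. [:\<iota> [:c:]:]) (ring_on D) (\<lambda>c. [:\<iota> [:c:]:])"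
  obtains h k where "iso_pair C D h k"
proof -
  obtain h where h: "h \<in> ring_iso (ring_on C) (ring_on D)" "\<And>c. h [:\<iota> [:c:]:] = [:\<iota> [:c:]:]"
    using assms by (auto simp: alg_isomorphic_def)
  have bij: "bij_betw h C D" using ring_iso_memE(5)[OF h(1)] by simp
  have "iso_pair C D h (inv_into C h)"
    unfolding iso_pair_def
    using ring_iso_memE(2,3)[OF h(1)] h(2) bij
    by (auto simp: bij_betw_inv_into_left bij_betw_inv_into_right inv_into_into bij_betwE
        dest: bij_betw_imp_surj_on)
  then show thesis by (rule that)
qed

lemma map_poly_hom_on:
  fixes h :: "'a::comm_ring_1 \<Rightarrow> 'b::comm_ring_1"
  assumes C: "ring_closed C"
    and add: "\<And>u v. u \<in> C \<Longrightarrow> v \<in> C \<Longrightarrow> h (u + v) = h u + h v"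
    and mult: "\<And>u v. u \<in> C \<Longrightarrow> v \<in> C \<Longrightarrow> h (u * v) = h u * h v"
    and p: "p \<in> polyset C" and q: "q \<in> polyset C"
  shows "map_poly h (p + q) = map_poly h p + map_poly h q"
    and "map_poly h (p * q) = map_poly h p * map_poly h q"
proof -
  have h0: "h 0 = 0" using add[OF ring_closedD(1)[OF C] ring_closedD(1)[OF C]] by simp
  have pq: "coeff p i \<in> C" "coeff q i \<in> C" for i using p q by (auto simp: polyset_def)
  have sum: "sum u A \<in> C \<and> h (sum u A) = (\<Sum>i\<in>A. h (u i))" if "\<And>i. i \<in> A \<Longrightarrow> u i \<in> C"
    for u :: "nat \<Rightarrow> 'a" and A
    using that
    by (induction A rule: infinite_finite_induct) (auto simp: h0 add ring_closedD[OF C])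
  show "map_poly h (p + q) = map_poly h p + map_poly h q"
    by (rule poly_eqI) (simp add: coeff_map_poly h0 add pq)
  show "map_poly h (p * q) = map_poly h p * map_poly h q"
    by (rule poly_eqI) (simp add: coeff_map_poly h0 coeff_mult sum pq ring_closedD(4)[OF C] mult)
qed

text \<open>The additive group action \<open>Z \<mapsto> Z + q S\<close>, which fixes \<open>X\<close>.\<close>

definition flow :: "'k::field poly \<Rightarrow> 'k fls poly \<Rightarrow> 'k fls poly poly"
  where "flow q = pev (\<lambda>c. [:[:c:]:]) [:[:0, 1:], [:\<iota> q:]:]"

lemma rhom_flow: "rhom (flow q)"
  unfolding flow_def by (rule cc0.rhom_pev)

interpretation flow: rhom "flow q" for q by (rule rhom_flow)

lemma flow_const: "flow q [:c:] = [:[:c:]:]"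
  by (simp add: flow_def cc0.pev_const)

lemma coeff_0_flow: "coeff (flow q u) 0 = u"
proof -
  have "rhom (\<lambda>u. coeff (flow q u) 0)" by (rule rhom_comp[OF rhom_flow rhom_coeff_0])
  from rhom_eq_pev[OF this, of u] have "coeff (flow q u) 0 = pev (\<lambda>c. [:c:]) [:0, 1:] u"
    by (simp add: flow_const) (simp add: flow_def cc0.pev_X)
  also have "\<dots> = u"
    using rhom_eq_pev[of "\<lambda>u. u" u] by (simp add: rhom_def)
  finally show ?thesis .
qed

lemma degree_flow: "q \<noteq> 0 \<Longrightarrow> degree (flow q u) = degree u"
  by (simp add: flow_def degree_pev_cc0 \<iota>_eq_0_iff)

text \<open>The action is defined on the surface: \<open>\<phi>(Z + q S)/q\<close> is \<open>Y\<close> plus a polynomial in \<open>X\<close>, \<open>Z\<close> and \<open>S\<close>.\<close>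

lemma flow_mem:
  fixes \<phi> :: "'k::field poly poly"
  assumes "q \<noteq> 0" "u \<in> surf q \<phi>"
  shows "flow q u \<in> cylinder q \<phi>"
proof -
  let ?S = "cylinder q \<phi>" and ?Z = "[:[:0, 1:]:] :: 'k fls poly poly" and ?T = "[:0, 1:] :: 'k fls poly poly"
  note S = ring_closedD[OF ring_closed_cyl[of q \<phi>]]
  define a where "a = ?Z + cc q * ?T"
  have a: "a = [:[:0, 1:], [:\<iota> q:]:]" by (simp add: a_def cc_def)
  have QT: "cc q * ?T \<in> ?S" by (intro S cyl_gens)
  obtain \<rho> where \<rho>: "\<rho> \<in> ?S"
    "pev cc a \<phi> = pev cc ?Z \<phi> + (cc q * ?T) * pev cc ?Z (pderiv \<phi>) + (cc q * ?T) ^ 2 * \<rho>"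
    using taylor_second_order[OF rhom_cc ring_closed_cyl cyl_gens(1) cyl_gens(2) QT, of \<phi>]
    by (auto simp: a_def)
  let ?H = "subst2 a ?T"
  define V where "V = [:ycoord q \<phi>:] + ?T * pev cc ?Z (pderiv \<phi>) + cc q * ?T ^ 2 * \<rho>"
  have V: "V \<in> ?S"
    unfolding V_def by (intro S cyl_gens \<rho> pev_mem rhom_cc ring_closed_cyl)
  have "cc q * ?H [:ycoord q \<phi>:] = ?H [:\<epsilon> \<phi>:]"
    using arg_cong[OF cc_ycoord[OF assms(1), of \<phi>], of ?H] by (simp only: subst2.hom_mult subst2_simps)
  also have "\<dots> = pev cc a \<phi>" by (simp only: subst2_simps)
  also have "\<dots> = cc q * V"
    unfolding \<rho>(2) V_def const_eq_pev[symmetric] cc_ycoord[OF assms(1), of \<phi>, symmetric]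
    by (simp only: power2_eq_square distrib_left mult_ac)
  finally have eq: "cc q * ?H [:ycoord q \<phi>:] = cc q * V" .
  have ccq: "cc q \<noteq> 0" using assms(1) by (simp add: cc_def \<iota>_eq_0_iff)
  have "?H [:ycoord q \<phi>:] = V" by (rule mult_left_cancel[OF ccq, THEN iffD1, OF eq])
  then have HY: "?H [:ycoord q \<phi>:] \<in> ?S" using V by simp
  have "0 \<in> surf q \<phi>" by (rule ring_closedD(1)[OF ring_closed_surf])
  then have u: "[:u:] \<in> ?S"
    using assms(2) unfolding polyset_def by (simp add: coeff_pCons split: nat.splits)
  have "a \<in> ?S" unfolding a_def by (intro S cyl_gens)
  then have "?H [:u:] \<in> ?S"
    by (intro cyl_hom_mem[OF rhom_subst2 ring_closed_cyl u] HY) (simp_all add: subst2_simps cyl_gens)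
  moreover have "?H [:u:] = flow q u"
    by (simp add: subst2_def flow_def rhom.pev_const[OF cc0.rhom_pev] a)
  ultimately show ?thesis by simp
qed

locale surfaces =
  fixes \<phi> \<alpha> \<beta> :: "'k::field poly poly"
  assumes monic: "lead_coeff \<phi> = 1" and deg: "2 \<le> degree \<phi>"
    and bez: "\<alpha> * \<phi> + \<beta> * pderiv \<phi> = 1"
begin

lemma pos: "0 < degree \<phi>" using deg by simp

text \<open>Below degree \<open>d\<close> in \<open>Z\<close> the normal form does not contain \<open>Y\<close>.\<close>

lemma low_degree:
  assumes q: "q \<noteq> 0" and u: "u \<in> surf q \<phi>" and d: "degree u < degree \<phi>"
  obtains c where "u = \<epsilon> c"
proof -
  obtain P where P: "u = ev q \<phi> P" "\<And>i. degree (coeff P i) < degree \<phi>"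
    using surf_normal_form[OF monic pos q u] by blast
  show thesis
  proof (cases "P = 0")
    case True
    then show thesis using that[of 0] P(1) by (simp add: ev.hom_zero \<epsilon>.hom_zero)
  next
    case False
    have "degree P = 0"
      using normal_form_degree(1)[OF monic pos q P(2) False] d P(1) by (cases "degree P") auto
    then obtain c where "P = [:c:]" by (auto elim: degree_eq_zeroE)
    then show thesis using that P(1) by (simp add: ev_const)
  qed
qed

text \<open>Conjugating the action on the first surface by the isomorphism gives an action on the second one. It
  fixes the image of \<open>X\<close>, hence \<open>X\<close> itself; so the preimage of \<open>X\<close> is fixed by the original action,
  whose invariants are the elements of degree \<open>0\<close> in \<open>Z\<close>.\<close>

lemma X_preimage:
  assumes q1: "q1 \<noteq> 0" and n: "2 \<le> n" and g: "coeff g 0 \<noteq> 0" and q2: "q2 = [:0, 1:] ^ n * g"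
    and iso: "iso_pair (surf q1 \<phi>) (surf q2 \<phi>) h k"
  obtains r where "k [:\<iota> [:0, 1:]:] = [:\<iota> r:]"
proof -
  note I = iso_pairD[OF iso]
  note J = iso_pairD[OF iso_pair_sym[OF iso]]
  define E where "E u = map_poly h (flow q1 (k u))" for u
  define H where "H P = E (ev q2 \<phi> P)" for P
  have h0: "h 0 = 0" using I(7)[of 0] by (simp add: \<iota>.hom_zero)
  have ev_mem: "ev q2 \<phi> P \<in> surf q2 \<phi>" for P by (simp add: surf_def)
  have fl: "flow q1 (k u) \<in> cylinder q1 \<phi>" if "u \<in> surf q2 \<phi>" for u
    by (rule flow_mem[OF q1 I(3)[OF that]])
  have hom: "map_poly h (p + p') = map_poly h p + map_poly h p'" "map_poly h (p * p') = map_poly h p * map_poly h p'"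
    if "p \<in> cylinder q1 \<phi>" "p' \<in> cylinder q1 \<phi>" for p p'
    using map_poly_hom_on[OF ring_closed_surf _ _ that] I(5,6) by blast+
  have k_const: "k [:\<iota> [:c:]:] = [:\<iota> [:c:]:]" for c by (rule J(7))
  have E_const: "E [:\<iota> [:c:]:] = [:[:\<iota> [:c:]:]:]" for c
    by (simp add: E_def k_const flow_const map_poly_pCons h0 I(7))
  have rhom: "rhom H"
  proof
    fix P Q
    show "H (P + Q) = H P + H Q"
      by (simp add: H_def E_def ev.hom_add J(5)[OF ev_mem ev_mem] flow.hom_add hom(1)[OF fl[OF ev_mem] fl[OF ev_mem]])
    show "H (P * Q) = H P * H Q"
      by (simp add: H_def E_def ev.hom_mult J(6)[OF ev_mem ev_mem] flow.hom_mult hom(2)[OF fl[OF ev_mem] fl[OF ev_mem]])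
    show "H 1 = 1"
      using E_const[of 1] by (simp add: H_def ev.hom_one \<iota>.hom_one flip: one_pCons)
  qed
  have q20: "q2 \<noteq> 0" using g by (auto simp: q2)
  obtain T where T: "ev q2 \<phi> T = h [:\<iota> [:0, 1:]:]"
    using I(1)[OF surf_mem(2), of "[:0, 1:]"] unfolding surf_def by (metis rangeE)
  have "degree (H [:[:[:0, 1:]:]:]) = 0"
  proof (rule coordinate_X_invariant[OF monic deg bez n g, folded q2, OF rhom])
    show "H [:[:[:c:]:]:] = [:[:\<iota> [:c:]:]:]" for c
      by (simp add: H_def ev_const \<epsilon>_const E_const)
    show "H (surf_rel q2 \<phi>) = 0"
      using E_const[of 0] by (simp add: H_def ev_rel[OF q20] \<iota>.hom_zero)
    show "coeff (H P) 0 = ev q2 \<phi> P" for P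
      by (simp add: H_def E_def coeff_map_poly h0 coeff_0_flow I(4)[OF ev_mem])
    show "degree (H T) = 0"
      by (simp add: H_def E_def T I(2)[OF surf_mem(2)] flow_const map_poly_pCons h0)
    show "ev q2 \<phi> T \<noteq> [:\<iota> [:c:]:]" for c
    proof
      assume "ev q2 \<phi> T = [:\<iota> [:c:]:]"
      then have "k (h [:\<iota> [:0, 1:]:]) = [:\<iota> [:c:]:]" by (simp add: T k_const)
      then show False by (simp add: I(2)[OF surf_mem(2)] \<iota>_eq_iff)
    qed
  qed
  then have "degree (map_poly h (flow q1 (k [:\<iota> [:0, 1:]:]))) = 0"
    by (simp add: H_def E_def ev_const \<epsilon>_const)
  moreover have "degree (map_poly h p) = degree p" if "p \<in> cylinder q1 \<phi>" for p
  proof (cases "p = 0")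
    case False
    have "lead_coeff p \<in> surf q1 \<phi>" using that by (simp add: polyset_def)
    then have "k (h (lead_coeff p)) = lead_coeff p" by (rule I(2))
    then have "h (lead_coeff p) \<noteq> 0" using k_const[of 0] False by (auto simp: \<iota>.hom_zero)
    then show ?thesis by (rule map_poly_degree_eq)
  qed simp
  ultimately have "degree (k [:\<iota> [:0, 1:]:]) = 0"
    using fl[OF surf_mem(2)] by (simp add: degree_flow[OF q1])
  then obtain c where c: "k [:\<iota> [:0, 1:]:] = \<epsilon> c"
    using low_degree[OF q1 I(3)[OF surf_mem(2)]] pos by metis
  have "degree c = 0" using \<open>degree (k _) = 0\<close> by (simp add: c degree_\<epsilon>)
  then obtain r where "c = [:r:]" by (auto elim: degree_eq_zeroE)
  then show thesis using that c by (simp add: \<epsilon>_const)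
qed


text \<open>As \<open>h\<close> maps \<open>K[X]\<close> onto \<open>K[X]\<close>, it multiplies degrees in \<open>Z\<close> by the degree of \<open>h Z\<close>, which must then be \<open>1\<close>. So
  \<open>h Y\<close> has degree \<open>d\<close> and leading coefficient \<open>\<mu>\<^sup>d\<close> divided by a polynomial of degree \<open>deg q1\<close>, with \<open>\<mu>\<close> a nonzero constant. But the normal form
  of an element of degree \<open>d\<close> is linear in \<open>Y\<close>, and its leading coefficient is a
  polynomial divided by \<open>q2\<close>.\<close>

lemma degree_le_degree:
  assumes n1: "2 \<le> n1" and g1: "coeff g1 0 \<noteq> 0" and q1: "q1 = [:0, 1:] ^ n1 * g1"
    and n2: "2 \<le> n2" and g2: "coeff g2 0 \<noteq> 0" and q2: "q2 = [:0, 1:] ^ n2 * g2"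
    and iso: "iso_pair (surf q1 \<phi>) (surf q2 \<phi>) h k"
  shows "degree q1 \<le> degree q2"
proof -
  note I = iso_pairD[OF iso]
  note C = ring_closedD[OF ring_closed_surf[of q1 \<phi>]]
  have q10: "q1 \<noteq> 0" and q20: "q2 \<noteq> 0" using g1 g2 by (auto simp: q1 q2)
  obtain r where r: "k [:\<iota> [:0, 1:]:] = [:\<iota> r:]"
    by (rule X_preimage[OF q10 n2 g2 q2 iso])
  obtain s where s: "h [:\<iota> [:0, 1:]:] = [:\<iota> s:]"
    by (rule X_preimage[OF q20 n1 g1 q1 iso_pair_sym[OF iso]])
  let ?z = "h [:0, 1:]" and ?c = "\<lambda>p. [:\<iota> (pcompose p s):]"
  have rhom_s: "rhom (\<lambda>p. \<iota> (pcompose p s))"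
    by (rule rhom_comp[OF rhom_pcompose rhom_\<iota>])
  have h_r: "h [:\<iota> p:] = ?c p" for p
  proof (induction p)
    case 0
    then show ?case using I(7)[of 0] by simp
  next
    case (pCons a p)
    have "pCons a p = [:a:] + [:0, 1:] * p" by simp
    then have "[:\<iota> (pCons a p):] = [:\<iota> [:a:]:] + [:\<iota> [:0, 1:]:] * [:\<iota> p:]"
      by (simp only: \<iota>.hom_simps rhom.hom_simps[OF rhom_const])
    then have "h [:\<iota> (pCons a p):] = [:\<iota> [:a:]:] + [:\<iota> s:] * ?c p"
      by (simp only: I(5)[OF surf_mem(2) C(4)[OF surf_mem(2) surf_mem(2)]] I(6)[OF surf_mem(2) surf_mem(2)] I(7) s pCons.IH)
    then show ?case
      by (simp only: pcompose_pCons \<iota>.hom_simps rhom.hom_simps[OF rhom_const])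
  qed
  have "[:\<iota> [:0, 1:]:] = [:\<iota> (pcompose r s):]"
    using I(4)[OF surf_mem(2), of "[:0, 1:]"] by (simp add: r h_r)
  then have "pcompose r s = [:0, 1:]" by (simp add: \<iota>_eq_iff)
  then have "degree r * degree s = 1" by (metis degree_pcompose degree_pCons_eq_if one_neq_zero degree_1 one_pCons pCons_eq_0_iff One_nat_def)
  then have ds: "degree s = 1" by simp
  then have s_inj: "pcompose p s = 0 \<longleftrightarrow> p = 0" for p by (simp add: pcompose_eq_0_iff)

  have h_\<epsilon>: "h (\<epsilon> p) = pcompose (map_poly (\<lambda>p. \<iota> (pcompose p s)) p) ?z" for p
  proof (induction p)
    case 0
    then show ?case using I(7)[of 0] by (simp add: \<iota>.hom_zero \<epsilon>.hom_zero)
  next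
    case (pCons a p)
    have "\<epsilon> (pCons a p) = [:\<iota> a:] + [:0, 1:] * \<epsilon> p" by (simp add: \<epsilon>_pCons)
    then have "h (\<epsilon> (pCons a p)) = ?c a + ?z * h (\<epsilon> p)"
      by (simp only: I(5)[OF surf_mem(2) C(4)[OF surf_mem(3) surf_mem(1)]] I(6)[OF surf_mem(3) surf_mem(1)] h_r)
    then show ?case
      by (simp add: pCons.IH pcompose_pCons rhom.map_poly_pCons'[OF rhom_s])
  qed
  have dm: "degree (map_poly (\<lambda>p. \<iota> (pcompose p s)) p) = degree p" for p
    by (rule degree_map_poly) (simp add: \<iota>_eq_0_iff s_inj)
  have d\<epsilon>: "degree (h (\<epsilon> p)) = degree p * degree ?z" for p
    by (simp add: h_\<epsilon> degree_pcompose dm)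
  have l\<epsilon>: "lead_coeff (h (\<epsilon> p)) = \<iota> (pcompose (lead_coeff p) s) * lead_coeff ?z ^ degree p"
    if "degree ?z > 0" for p
    unfolding h_\<epsilon> using lead_coeff_comp[OF that, of "map_poly (\<lambda>p. \<iota> (pcompose p s)) p"]
    by (simp add: dm rhom.coeff_hom[OF rhom_s])

  \<comment> \<open>A power of \<open>q1\<close> clears the denominators of an element of \<open>surf q1 \<phi>\<close>, so that the degree
    formula just found for \<open>K[X,Z]\<close> holds on the whole subring.\<close>
  have clear: "\<exists>m U. [:\<iota> (q1 ^ m):] * ev q1 \<phi> P = \<epsilon> U" for P
  proof (induction P)
    case 0
    show ?case by (intro exI[of _ 0]) (simp add: ev.hom_zero \<epsilon>.hom_zero)
  next
    case (pCons a P)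
    then obtain m U where U: "[:\<iota> (q1 ^ m):] * ev q1 \<phi> P = \<epsilon> U" by blast
    have Y: "[:\<iota> q1:] * ycoord q1 \<phi> = \<epsilon> \<phi>" by (rule q_ycoord[OF q10])
    have "[:\<iota> (q1 ^ Suc m):] = [:\<iota> q1:] * [:\<iota> (q1 ^ m):]"
      by (simp add: \<iota>.hom_mult)
    then have "[:\<iota> (q1 ^ Suc m):] * ev q1 \<phi> (pCons a P)
      = [:\<iota> (q1 ^ Suc m):] * \<epsilon> a + ([:\<iota> q1:] * ycoord q1 \<phi>) * ([:\<iota> (q1 ^ m):] * ev q1 \<phi> P)"
      by (simp only: ev_pCons distrib_left mult_ac)
    also have "\<dots> = \<epsilon> ([:q1 ^ Suc m:] * a + \<phi> * U)"
      by (simp only: Y U \<epsilon>.hom_simps \<epsilon>_const)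
    finally show ?case by blast
  qed
  have dh: "degree (h u) = degree u * degree ?z" if u: "u \<in> surf q1 \<phi>" for u
  proof -
    obtain P where "u = ev q1 \<phi> P" using u unfolding surf_def by blast
    with clear obtain m U where U: "[:\<iota> (q1 ^ m):] * u = \<epsilon> U" by blast
    have "?c (q1 ^ m) * h u = h (\<epsilon> U)"
      unfolding U[symmetric] by (simp only: I(6)[OF surf_mem(2) u] h_r)
    moreover have "degree (?c (q1 ^ m) * h u) = degree (h u)"
      using q10 by (simp add: \<iota>_eq_0_iff s_inj)
    moreover have "degree (\<epsilon> U) = degree u"
      unfolding U[symmetric] using q10 by (simp add: \<iota>_eq_0_iff)
    ultimately show ?thesis by (metis d\<epsilon> degree_\<epsilon>)
  qed

  have "degree (h (k [:0, 1:])) = degree (k [:0, 1:]) * degree ?z"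
    by (rule dh[OF I(3)[OF surf_mem(3)]])
  then have "degree (k [:0, 1:]) * degree ?z = 1"
    by (simp add: I(4)[OF surf_mem(3)])
  then have dz: "degree ?z = 1" "degree (k [:0, 1:]) = 1" by auto
  obtain c where c: "?z = \<epsilon> c"
    using low_degree[OF q20 I(1)[OF surf_mem(3)]] dz deg by auto
  obtain c' where c': "k [:0, 1:] = \<epsilon> c'"
    using low_degree[OF q10 I(3)[OF surf_mem(3)]] dz deg by auto
  have dc: "degree c = 1" "degree c' = 1" using dz by (simp_all add: c c' degree_\<epsilon>)
  define \<mu> where "\<mu> = lead_coeff c"
  have lz: "lead_coeff ?z = \<iota> \<mu>" by (simp add: c degree_\<epsilon> coeff_\<epsilon> \<mu>_def)
  have unit: "degree \<mu> = 0"
  proof -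
    have "h (\<epsilon> c') = [:0, 1:]" using I(4)[OF surf_mem(3)] by (simp add: c')
    then have "\<iota> (pcompose (lead_coeff c') s) * \<iota> \<mu> = 1"
      using l\<epsilon>[of c'] dz(1) lz dc(2) by simp
    then have "pcompose (lead_coeff c') s * \<mu> = 1"
      by (simp add: \<iota>_eq_iff flip: \<iota>.hom_mult \<iota>.hom_one)
    then have "\<mu> dvd 1" by (metis dvd_triv_right)
    then show ?thesis using dvd_imp_degree_le[of \<mu> 1] by simp
  qed
  have "c \<noteq> 0" using dc(1) by auto
  then have \<mu>0: "\<mu> \<noteq> 0" unfolding \<mu>_def by (simp only: leading_coeff_0_iff not_False_eq_True)

  let ?y = "h (ycoord q1 \<phi>)"
  have ymem: "?y \<in> surf q2 \<phi>" by (rule I(1)[OF surf_mem(4)])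
  have y: "?c q1 * ?y = h (\<epsilon> \<phi>)"
    using I(6)[OF surf_mem(2) surf_mem(4), of q1] by (simp only: q_ycoord[OF q10] h_r)
  have dy: "degree ?y = degree \<phi>"
    using arg_cong[OF y, of degree] q10 by (simp add: d\<epsilon> dz \<iota>_eq_0_iff s_inj)
  have ly: "\<iota> (pcompose q1 s) * lead_coeff ?y = \<iota> \<mu> ^ degree \<phi>"
  proof -
    have "lead_coeff (?c q1 * ?y) = \<iota> (pcompose q1 s) * lead_coeff ?y"
      by (simp add: lead_coeff_mult)
    moreover have "0 < degree ?z" using dz(1) by simp
    then have "lead_coeff (h (\<epsilon> \<phi>)) = \<iota> \<mu> ^ degree \<phi>"
      unfolding l\<epsilon>[OF \<open>0 < degree ?z\<close>] lz monic pcompose_1 \<iota>.hom_one by simp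
    ultimately show ?thesis unfolding y by (simp only:)
  qed
  obtain P where P: "?y = ev q2 \<phi> P" "\<And>i. degree (coeff P i) < degree \<phi>"
    using surf_normal_form[OF monic pos q20 ymem] by blast
  have "P \<noteq> 0" using dy pos P(1) by (auto simp: ev.hom_zero)
  note D = normal_form_degree[OF monic pos q20 P(2) this]
  have "degree (lead_coeff P) + degree \<phi> * degree P = degree \<phi>" using D(1) dy P(1) by simp
  then have dP: "degree P = 1"
    using P(2)[of "degree P"] pos by (cases "degree P") (auto simp: mult_eq_self_implies_10)
  define l where "l = lead_coeff (lead_coeff P)"
  have "lead_coeff ?y = \<iota> l * inverse (\<iota> q2)"
    using D(2) by (simp only: P(1) dP l_def power_one_right)
  then have l: "\<iota> l = lead_coeff ?y * \<iota> q2"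
    using q20 by (simp add: \<iota>_eq_0_iff)
  have "\<iota> (pcompose q1 s * l) = \<iota> (\<mu> ^ degree \<phi> * q2)"
    unfolding \<iota>.hom_mult \<iota>.hom_power l ly[symmetric] by (rule mult.assoc[symmetric])
  then have eq: "pcompose q1 s * l = \<mu> ^ degree \<phi> * q2" by (simp only: \<iota>_eq_iff)
  have "l \<noteq> 0" using \<open>P \<noteq> 0\<close> by (simp add: l_def)
  then have "degree (pcompose q1 s * l) = degree q1 + degree l"
    using q10 by (simp add: degree_mult_eq s_inj degree_pcompose ds)
  moreover have "degree (\<mu> ^ degree \<phi> * q2) = degree q2"
    using \<mu>0 q20 unit by (simp add: degree_mult_eq degree_power_eq)
  ultimately show ?thesis using eq by simp
qed

end

section \<open>The family of surfaces\<close>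

lemma bezout_from_Idl:
  fixes a b :: "'a::comm_ring_1"
  assumes "Idl\<^bsub>ring_of_type_algebra\<^esub> {a, b} = UNIV"
  shows "\<exists>r s. r * a + s * b = 1"
proof -
  interpret R: cring "ring_of_type_algebra :: 'a ring" by (rule cring_from_type_algebra)
  let ?J = "{r * a + s * b | r s. True}"
  have "ideal ?J (ring_of_type_algebra :: 'a ring)"
  proof (rule idealI[OF R.ring_axioms])
    show "subgroup ?J (add_monoid (ring_of_type_algebra :: 'a ring))"
    proof (rule R.add.subgroupI)
      show "?J \<noteq> {}" by blast
      show "x \<oplus>\<^bsub>ring_of_type_algebra\<^esub> y \<in> ?J" if xy: "x \<in> ?J" "y \<in> ?J" for x y
      proof -
        obtain r s r' s' where "x = r * a + s * b" "y = r' * a + s' * b" using xy by blast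
        then have "x + y = (r + r') * a + (s + s') * b" by (simp add: algebra_simps)
        then show ?thesis by auto
      qed
      show "\<ominus>\<^bsub>ring_of_type_algebra\<^esub> x \<in> ?J" if x: "x \<in> ?J" for x
      proof -
        obtain r s where "x = r * a + s * b" using x by blast
        then have "- x = (- r) * a + (- s) * b" by simp
        then have "- x \<in> ?J" by blast
        moreover have "\<ominus>\<^bsub>ring_of_type_algebra\<^esub> x = - x"
          by (rule R.minus_equality) simp_all
        ultimately show ?thesis by simp
      qed
    qed simp
  next
    fix x y assume "x \<in> ?J"
    then obtain r s where x: "x = r * a + s * b" by blast
    have "y * x = (y * r) * a + (y * s) * b" by (simp add: x algebra_simps)
    then have "y * x \<in> ?J" by blast
    then show "y \<otimes>\<^bsub>ring_of_type_algebra\<^esub> x \<in> ?J" "x \<otimes>\<^bsub>ring_of_type_algebra\<^esub> y \<in> ?J"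
      by (simp_all only: type_algebra_simps mult.commute[of x y])
  qed
  moreover have "a = 1 * a + 0 * b" "b = 0 * a + 1 * b" by simp_all
  then have "{a, b} \<subseteq> ?J" by blast
  ultimately have "Idl\<^bsub>ring_of_type_algebra\<^esub> {a, b} \<subseteq> ?J"
    by (rule R.genideal_minimal)
  then have "1 \<in> ?J" using assms by blast
  then obtain r s where "1 = r * a + s * b" by blast
  then show ?thesis by metis
qed

lemma cylinder_isomorphic_first_power:
  fixes \<phi> :: "'k::field poly poly"
  assumes bez: "\<alpha> * \<phi> + \<beta> * pderiv \<phi> = 1" and g: "g \<noteq> 0" and n: "1 \<le> n"
  shows "alg_isomorphic (ring_on (cylinder ([:0, 1:] ^ n * g) \<phi>)) (\<lambda>c. [:[:\<iota> [:c:]:]:])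
    (ring_on (cylinder ([:0, 1:] ^ 1 * g) \<phi>)) (\<lambda>c. [:[:\<iota> [:c:]:]:])"
  using n
proof (induction n rule: dec_induct)
  case base
  have "id \<in> ring_iso (ring_on C) (ring_on C)" for C :: "'k fls poly poly set"
    by (rule ring_iso_memI) auto
  then show ?case unfolding alg_isomorphic_def by (intro bexI[of _ id]) auto
next
  case (step n)
  obtain m where m: "n = Suc m" using step(1) by (cases n) auto
  have eq: "[:0, 1:] * ([:0, 1:] ^ m * g) = [:0, 1:] ^ n * g"
    "[:0, 1:] * ([:0, 1:] ^ n * g) = [:0, 1:] ^ Suc n * g"
    by (simp_all only: m power_Suc mult.assoc)
  have "alg_isomorphic (ring_on (cylinder ([:0, 1:] * ([:0, 1:] * ([:0, 1:] ^ m * g))) \<phi>)) (\<lambda>c. [:[:\<iota> [:c:]:]:])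
    (ring_on (cylinder ([:0, 1:] * ([:0, 1:] ^ m * g)) \<phi>)) (\<lambda>c. [:[:\<iota> [:c:]:]:])"
    by (rule cylinder_isomorphic[OF bez]) (use g in auto)
  from alg_isomorphic_trans[OF this[unfolded eq] step.IH] show ?case .
qed

theorem theorem5p2:
  fixes g :: "'k::field poly" and \<phi> :: "'k poly poly" and n m :: nat
  assumes "g \<noteq> 0"
    and "\<not> (\<exists>a. 2 \<le> Polynomial.order a g)"
    and "Polynomial.lead_coeff \<phi> = 1"
    and "2 \<le> Polynomial.degree \<phi>"
    and "Idl\<^bsub>ring_of_type_algebra\<^esub> {\<phi>, pderiv \<phi>} = UNIV"
    and "2 \<le> n" and "2 \<le> m" and "n \<noteq> m"
  shows "\<not> alg_isomorphic (surface_ring g \<phi> n) (surface_const g \<phi> n)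
                         (surface_ring g \<phi> m) (surface_const g \<phi> m)
    \<and> alg_isomorphic
        (UP (surface_ring g \<phi> n)) (up_const (surface_ring g \<phi> n) (surface_const g \<phi> n))
        (UP (surface_ring g \<phi> m)) (up_const (surface_ring g \<phi> m) (surface_const g \<phi> m))"
proof -
  obtain \<alpha> \<beta> where bez: "\<alpha> * \<phi> + \<beta> * pderiv \<phi> = 1"
    using bezout_from_Idl[OF assms(5)] by blast
  interpret surfaces \<phi> \<alpha> \<beta> by unfold_locales fact+
  let ?A = "\<lambda>n. surface_ring g \<phi> n" and ?c = "\<lambda>n. surface_const g \<phi> n"
  let ?q = "\<lambda>n. [:0, 1:] ^ n * g" and ?\<kappa> = "\<lambda>c. [:\<iota> [:c:]:] :: 'k fls poly"
  have ring: "ring (?A n)" for n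
    using cring_surface_ring by (rule cring.axioms(1))
  have const: "?c n c \<in> carrier (?A n)" for n c
    using ring_hom_closed[OF surface_const_ring_hom, of c g \<phi> n] by simp
  have model: "alg_isomorphic (?A n) (?c n) (ring_on (surf (?q n) \<phi>)) ?\<kappa>" for n
    by (rule surface_ring_iso_surf[OF monic pos assms(1)])

  \<comment> \<open>The leading form argument needs the exact power of \<open>X\<close> in \<open>X\<^sup>n g\<close>, so powers of \<open>X\<close> are moved out of \<open>g\<close>.\<close>
  obtain g1 where "g = [:- 0, 1:] ^ Polynomial.order 0 g * g1" "\<not> [:- 0, 1:] dvd g1"
    using order_decomp[OF assms(1), of 0] by blast
  then have g1: "g = [:0, 1:] ^ Polynomial.order 0 g * g1" "coeff g1 0 \<noteq> 0"
    unfolding poly_eq_0_iff_dvd[symmetric] by (simp_all add: poly_0_coeff_0)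
  have q: "?q n = [:0, 1:] ^ (n + Polynomial.order 0 g) * g1" for n
    by (subst g1(1)) (simp only: power_add mult.assoc)
  have le: "n \<le> m" if "2 \<le> n" "2 \<le> m" "iso_pair (surf (?q n) \<phi>) (surf (?q m) \<phi>) h k" for n m h k
  proof -
    have "degree (?q n) \<le> degree (?q m)"
      by (rule degree_le_degree[OF _ g1(2) q _ g1(2) q that(3)]) (use that in auto)
    moreover have "degree (?q n) = n + degree g" for n
      using assms(1) by (simp add: degree_mult_eq degree_power_eq)
    ultimately show ?thesis by simp
  qed
  have "\<not> alg_isomorphic (?A n) (?c n) (?A m) (?c m)"
  proof
    assume "alg_isomorphic (?A n) (?c n) (?A m) (?c m)"
    from alg_isomorphic_trans[OF alg_isomorphic_sym[OF ring const model] alg_isomorphic_trans[OF this model]]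
    obtain h k where iso: "iso_pair (surf (?q n) \<phi>) (surf (?q m) \<phi>) h k"
      by (rule alg_isomorphic_iso_pair)
    have "n \<le> m" by (rule le[OF assms(6,7) iso])
    moreover have "m \<le> n" by (rule le[OF assms(7,6) iso_pair_sym[OF iso]])
    ultimately show False using assms(8) by simp
  qed
  moreover have "alg_isomorphic (UP (?A n)) (up_const (?A n) (?c n)) (UP (?A m)) (up_const (?A m) (?c m))"
  proof -
    have to1: "alg_isomorphic (UP (?A n)) (up_const (?A n) (?c n)) (ring_on (cylinder (?q 1) \<phi>)) (\<lambda>c. [:?\<kappa> c:])"
      if "1 \<le> n" for n
      by (rule alg_isomorphic_trans[OF UP_alg_isomorphic[OF ring const model]
            cylinder_isomorphic_first_power[OF bez assms(1) that]])
    have U: "UP_ring (?A m)" using ring by (simp add: UP_ring_def)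
    have "ring (UP (?A m))" by (rule UP_ring.UP_ring[OF U])
    moreover have "up_const (?A m) (?c m) c \<in> carrier (UP (?A m))" for c
      unfolding up_const_def by (rule UP_ring.monom_closed[OF U const])
    moreover have nm: "1 \<le> m" "1 \<le> n" using assms(6,7) by simp_all
    ultimately have "alg_isomorphic (ring_on (cylinder (?q 1) \<phi>)) (\<lambda>c. [:?\<kappa> c:]) (UP (?A m)) (up_const (?A m) (?c m))"
      by (intro alg_isomorphic_sym[OF _ _ to1[OF nm(1)]])
    then show ?thesis by (rule alg_isomorphic_trans[OF to1[OF nm(2)]])
  qed
  ultimately show ?thesis by blast
qed

end
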